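(* a) Let $n=3$. Write the symmetric matrix of a form in $\Xi(3)$ as $$\begin{pmatrix} 1 & p & q_1 \\ p & 1 & r_1 \\ q_1 & r_1 & 1 \end{pmatrix}.$$ The pushforward of the Haar measure of $G(3)$ under the map $\zeta:\Pi(3)\to\Xi(3)$ is $$\mathrm{const}\cdot dp\,dq_1\,dr_1$$ on $\Xi(3)$. b) Let $n=4$. Write the symmetric matrix of a form in $\Xi(4)$ as $$\begin{pmatrix} 1 & p & q_1 & q_2 \\ p & 1 & r_1 & r_2 \\ q_1 & r_1 & 1 & t_{12} \\ q_2 & r_2 & t_{12} & 1 \end{pmatrix}.$$ The image of the Haar measure of $G(4)$ under the map $\zeta:\Pi(4)\to\Xi(4)$ is $$\mathrm{const}\cdot\det\begin{pmatrix} 1 & p & q_1 & q_2 \\ p & 1 & r_1 & r_2 \\ q_1 & r_1 & 1 & t_{12} \\ q_2 & r_2 & t_{12} & 1 \end{pmatrix}^{-1/2}dp\,dq_1\,dq_2\,dr_1\,dr_2\,dt_{12}$$ on $\Xi(4)$. Here $\mathrm{const}$ denotes a positive constant and $dp\,dq_1\cdots$ is Lebesgue measure in the indicated matrix entries.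
   Context: $G(n)=\mathrm{SU}(2)^n$ with its Haar measure, and $K(n)\subset G(n)$ is the diagonal subgroup. $\Pi(n)=K(n)\backslash G(n)/K(n)$ is the set of $n$-tuples $(g_1,\dots,g_n)\in G(n)$ modulo $(g_1,\dots,g_n)\sim(hg_1q,\dots,hg_nq)$, $h,q\in\mathrm{SU}(2)$; the Haar measure of $G(n)$ is regarded as a measure on $\Pi(n)$ by pushforward under the quotient map. $\Xi(n)$ is the set of real positive semidefinite quadratic forms $\sum_{i,j}s_{ij}\lambda_i\lambda_j$ ($s_{ij}=s_{ji}$) in $n$ variables of rank at most $4$ with $s_{jj}=1$ for all $j$. The map $\zeta:\Pi(n)\to\Xi(n)$ sends the class of $(g_1,\dots,g_n)$ to the spectral form $\det\bigl(\sum_j\lambda_jg_j\bigr)$. *)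

theory Defs
  imports "HOL-Probability.Probability_Measure"
begin

definition adjoint_matrix :: "complex^'n^'m \<Rightarrow> complex^'m^'n" where
  "adjoint_matrix A = map_matrix cnj (transpose A)"

definition SU2 :: "(complex^2^2) set" where
  "SU2 = {A. adjoint_matrix A ** A = mat 1 \<and> A ** adjoint_matrix A = mat 1 \<and> det A = 1}"

definition G :: "((complex^2^2)^'n) set" where
  "G = {g. \<forall>j. g $ j \<in> SU2}"

definition G_mult :: "(complex^2^2)^'n \<Rightarrow> (complex^2^2)^'n \<Rightarrow> (complex^2^2)^'n" where
  "G_mult g h = (\<chi> j. g $ j ** h $ j)"

definition K :: "((complex^2^2)^'n) set" where
  "K = {k. \<exists>h\<in>SU2. k = (\<chi> j. h)}"

definition G_borel :: "((complex^2^2)^'n) measure" where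
  "G_borel = restrict_space borel G"

text \<open>The Haar measure of the compact group is the left-invariant Borel probability measure;
  it is unique, so a theorem about every \<open>M\<close> with \<open>haar_measure_G M\<close> is a theorem about it.\<close>

definition haar_measure_G :: "((complex^2^2)^'n) measure \<Rightarrow> bool" where
  "haar_measure_G M \<longleftrightarrow>
     sets M = sets G_borel \<and> prob_space M \<and> (\<forall>h\<in>G. distr M M (G_mult h) = M)"

definition double_coset :: "(complex^2^2)^'n \<Rightarrow> ((complex^2^2)^'n) set" where
  "double_coset g = {G_mult (G_mult h g) q | h q. h \<in> K \<and> q \<in> K}"

definition Pi_space :: "((complex^2^2)^'n) set set" where
  "Pi_space = double_coset ` G"

text \<open>The Borel \<open>\<sigma>\<close>-algebra of the quotient topology.\<close>

definition Pi_borel :: "((complex^2^2)^'n) set measure" where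
  "Pi_borel = sigma Pi_space
     {U. U \<subseteq> Pi_space \<and> openin (top_of_set G) {g \<in> G. double_coset g \<in> U}}"

text \<open>Quadratic forms are identified with their symmetric matrices throughout.\<close>

definition quad_form :: "real^'n^'n \<Rightarrow> real^'n \<Rightarrow> real" where
  "quad_form S x = (\<Sum>i\<in>UNIV. \<Sum>j\<in>UNIV. S $ i $ j * x $ i * x $ j)"

definition Xi :: "(real^'n^'n) set" where
  "Xi = {S. transpose S = S \<and> (\<forall>x. 0 \<le> quad_form S x) \<and> rank S \<le> 4 \<and> (\<forall>j. S $ j $ j = 1)}"

definition Xi_borel :: "(real^'n^'n) measure" where
  "Xi_borel = restrict_space borel Xi"

text \<open>The form \<open>det (\<Sum>\<^sub>j x\<^sub>j g\<^sub>j)\<close>, which does not depend on the representative \<open>g\<close> of the class;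
  see \<open>zeta_double_coset\<close> and \<open>zeta_in_Xi\<close> below.\<close>

definition zeta :: "((complex^2^2)^'n) set \<Rightarrow> real^'n^'n" where
  "zeta C = (THE S. transpose S = S \<and>
     (\<forall>g\<in>C. \<forall>x. det (\<Sum>j\<in>UNIV. x $ j *\<^sub>R g $ j) = complex_of_real (quad_form S x)))"

definition form3 :: "real \<times> real \<times> real \<Rightarrow> real^3^3" where
  "form3 = (\<lambda>(p, q1, r1). vector [
     vector [1,  p,  q1],
     vector [p,  1,  r1],
     vector [q1, r1, 1]])"

definition form4 :: "real \<times> real \<times> real \<times> real \<times> real \<times> real \<Rightarrow> real^4^4" where
  "form4 = (\<lambda>(p, q1, q2, r1, r2, t12). vector [
     vector [1,  p,  q1,  q2],
     vector [p,  1,  r1,  r2],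
     vector [q1, r1, 1,   t12],
     vector [q2, r2, t12, 1]])"

text \<open>The coordinate maps restrict to bijections onto \<open>\<Xi>(3)\<close> and \<open>\<Xi>(4)\<close>
  (\<open>bij_form3\<close> and \<open>bij_form4\<close> below), so these measures are Lebesgue measure in the
  off-diagonal entries, with a density \<open>w\<close>.  For \<open>w S = c * det S powr (- 1 / 2)\<close> note that
  \<open>0 powr (- 1 / 2) = 0\<close>; the forms with \<open>det S = 0\<close> are a null set.\<close>

definition Xi3_measure :: "(real^3^3 \<Rightarrow> real) \<Rightarrow> (real^3^3) measure" where
  "Xi3_measure w =
     distr (density (restrict_space lborel (form3 -` Xi)) (\<lambda>x. ennreal (w (form3 x)))) Xi_borel form3"

definition Xi4_measure :: "(real^4^4 \<Rightarrow> real) \<Rightarrow> (real^4^4) measure" where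
  "Xi4_measure w =
     distr (density (restrict_space lborel (form4 -` Xi)) (\<lambda>x. ennreal (w (form4 x)))) Xi_borel form4"

subsection \<open>The notions above are well defined\<close>

lemma vector_4_nth:
  "(vector [a, b, c, d] :: 'a::zero^4) $ 1 = a"
  "(vector [a, b, c, d] :: 'a::zero^4) $ 2 = b"
  "(vector [a, b, c, d] :: 'a::zero^4) $ 3 = c"
  "(vector [a, b, c, d] :: 'a::zero^4) $ 4 = d"
  by (simp_all add: vector_def)

lemma transpose_symmetric:
  assumes "transpose S = S"
  shows "S $ i $ j = S $ j $ i"
proof -
  have "transpose S $ i $ j = S $ j $ i" by (simp add: transpose_def)
  then show ?thesis by (simp only: assms)
qed

lemma bij_form3: "bij_betw form3 (form3 -` Xi) Xi"
proof (rule bij_betwI')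
  fix x y assume "x \<in> form3 -` Xi" "y \<in> form3 -` Xi"
  show "(form3 x = form3 y) = (x = y)"
    by (cases x; cases y) (auto simp: form3_def vec_eq_iff forall_3)
next
  fix S :: "real^3^3" assume S: "S \<in> Xi"
  have sym: "S $ i $ j = S $ j $ i" for i j
    using S transpose_symmetric[of S i j] by (simp add: Xi_def)
  have "S = form3 (S$1$2, S$1$3, S$2$3)"
    using S sym[of 2 1] sym[of 3 1] sym[of 3 2]
    by (simp add: form3_def vec_eq_iff forall_3 Xi_def)
  then show "\<exists>x\<in>form3 -` Xi. S = form3 x" using S by (metis vimageI)
qed auto

lemma bij_form4: "bij_betw form4 (form4 -` Xi) Xi"
proof (rule bij_betwI')
  fix x y assume "x \<in> form4 -` Xi" "y \<in> form4 -` Xi"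
  show "(form4 x = form4 y) = (x = y)"
    by (cases x; cases y) (auto simp: form4_def vec_eq_iff forall_4 vector_4_nth)
next
  fix S :: "real^4^4" assume S: "S \<in> Xi"
  have sym: "S $ i $ j = S $ j $ i" for i j
    using S transpose_symmetric[of S i j] by (simp add: Xi_def)
  have "S = form4 (S$1$2, S$1$3, S$1$4, S$2$3, S$2$4, S$3$4)"
    using S sym[of 2 1] sym[of 3 1] sym[of 3 2] sym[of 4 1] sym[of 4 2] sym[of 4 3]
    by (simp add: form4_def vec_eq_iff forall_4 Xi_def vector_4_nth)
  then show "\<exists>x\<in>form4 -` Xi. S = form4 x" using S by (metis vimageI)
qed auto

lemma form3_measurable: "form3 \<in> measurable (restrict_space lborel (form3 -` Xi)) Xi_borel"
proof -
  have "(\<lambda>x. \<chi> i j. form3 x $ i $ j) = form3" by simp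
  moreover have "continuous_on UNIV (\<lambda>x. form3 x $ i $ j)" for i j
    using exhaust_3[of i] exhaust_3[of j]
    by (safe; simp add: form3_def case_prod_unfold; (intro continuous_intros)?)
  ultimately have "continuous_on UNIV form3"
    using continuous_on_vec_lambda[of UNIV "\<lambda>i x. \<chi> j. form3 x $ i $ j"]
      continuous_on_vec_lambda[of UNIV "\<lambda>j x. form3 x $ i $ j" for i] by simp
  then have "form3 \<in> borel_measurable lborel" by (simp add: borel_measurable_continuous_onI)
  then show ?thesis
    unfolding Xi_borel_def
    by (intro measurable_restrict_space2 measurable_restrict_space1) (auto simp: space_restrict_space)
qed

lemma form4_measurable: "form4 \<in> measurable (restrict_space lborel (form4 -` Xi)) Xi_borel"
proof -
  have "(\<lambda>x. \<chi> i j. form4 x $ i $ j) = form4" by simp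
  moreover have "continuous_on UNIV (\<lambda>x. form4 x $ i $ j)" for i j
    using exhaust_4[of i] exhaust_4[of j]
    by (safe; simp add: form4_def vector_4_nth case_prod_unfold; (intro continuous_intros)?)
  ultimately have "continuous_on UNIV form4"
    using continuous_on_vec_lambda[of UNIV "\<lambda>i x. \<chi> j. form4 x $ i $ j"]
      continuous_on_vec_lambda[of UNIV "\<lambda>j x. form4 x $ i $ j" for i] by simp
  then have "form4 \<in> borel_measurable lborel" by (simp add: borel_measurable_continuous_onI)
  then show ?thesis
    unfolding Xi_borel_def
    by (intro measurable_restrict_space2 measurable_restrict_space1) (auto simp: space_restrict_space)
qed

lemma SU2_iff:
  "A \<in> SU2 \<longleftrightarrow> A$2$1 = - cnj (A$1$2) \<and> A$2$2 = cnj (A$1$1) \<and> (cmod (A$1$1))\<^sup>2 + (cmod (A$1$2))\<^sup>2 = 1"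
proof
  assume A: "A \<in> SU2"
  have u: "adjoint_matrix A ** A = mat 1" and d: "A$1$1 * A$2$2 - A$1$2 * A$2$1 = 1"
    using A by (auto simp: SU2_def det_2)
  have e: "(adjoint_matrix A ** A)$i$j = mat 1$i$j" for i j by (simp add: u)
  have e1: "cnj (A$1$1) * A$1$1 + cnj (A$2$1) * A$2$1 = 1"
    and e2: "cnj (A$1$1) * A$1$2 + cnj (A$2$1) * A$2$2 = 0"
    using e[of 1 1] e[of 1 2]
    by (simp_all add: adjoint_matrix_def matrix_matrix_mult_def transpose_def sum_2 mat_def)
  have "A$2$2 = A$2$2 * (cnj (A$1$1) * A$1$1 + cnj (A$2$1) * A$2$1)" by (simp add: e1)
  also have "\<dots> = cnj (A$1$1) * (A$1$1 * A$2$2 - A$1$2 * A$2$1)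
      + A$2$1 * (cnj (A$1$1) * A$1$2 + cnj (A$2$1) * A$2$2)" by (simp add: algebra_simps)
  finally have a: "A$2$2 = cnj (A$1$1)" by (simp add: d e2)
  have "A$1$2 = A$1$2 * (cnj (A$1$1) * A$1$1 + cnj (A$2$1) * A$2$1)" by (simp add: e1)
  also have "\<dots> = A$1$1 * (cnj (A$1$1) * A$1$2 + cnj (A$2$1) * A$2$2)
      - cnj (A$2$1) * (A$1$1 * A$2$2 - A$1$2 * A$2$1)" by (simp add: algebra_simps)
  finally have "A$1$2 = - cnj (A$2$1)" by (simp add: d e2)
  then have b: "A$2$1 = - cnj (A$1$2)" by simp
  have "complex_of_real ((cmod (A$1$1))\<^sup>2 + (cmod (A$1$2))\<^sup>2) = 1"
    using d unfolding a b of_real_add complex_norm_square by simp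
  then have c: "(cmod (A$1$1))\<^sup>2 + (cmod (A$1$2))\<^sup>2 = 1" by (metis of_real_eq_1_iff)
  show "A$2$1 = - cnj (A$1$2) \<and> A$2$2 = cnj (A$1$1) \<and> (cmod (A$1$1))\<^sup>2 + (cmod (A$1$2))\<^sup>2 = 1"
    using a b c by simp
next
  assume r: "A$2$1 = - cnj (A$1$2) \<and> A$2$2 = cnj (A$1$1) \<and> (cmod (A$1$1))\<^sup>2 + (cmod (A$1$2))\<^sup>2 = 1"
  then have "complex_of_real ((cmod (A$1$1))\<^sup>2 + (cmod (A$1$2))\<^sup>2) = 1" by (metis of_real_1)
  then have n: "A$1$1 * cnj (A$1$1) + A$1$2 * cnj (A$1$2) = 1"
    unfolding of_real_add complex_norm_square .
  have n': "cnj (A$1$1) * A$1$1 + cnj (A$1$2) * A$1$2 = 1"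
    "A$1$2 * cnj (A$1$2) + A$1$1 * cnj (A$1$1) = 1"
    "cnj (A$1$2) * A$1$2 + cnj (A$1$1) * A$1$1 = 1"
    "cnj (A$1$1) * A$1$1 + A$1$2 * cnj (A$1$2) = 1"
    "cnj (A$1$2) * A$1$2 + A$1$1 * cnj (A$1$1) = 1" using n by (simp_all add: algebra_simps)
  show "A \<in> SU2"
    using r n n'
    by (simp add: SU2_def adjoint_matrix_def matrix_matrix_mult_def transpose_def sum_2 mat_def
        vec_eq_iff forall_2 det_2)
qed

text \<open>The matrix of the spectral form is the Gram matrix of the first rows, as vectors in \<open>\<real>\<^sup>4\<close>.\<close>

definition rows4 :: "(complex^2^2)^'n \<Rightarrow> real^4^'n" where
  "rows4 g = (\<chi> j. vector [Re (g$j$1$1), Im (g$j$1$1), Re (g$j$1$2), Im (g$j$1$2)])"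

definition gram :: "(complex^2^2)^'n \<Rightarrow> real^'n^'n" where
  "gram g = rows4 g ** transpose (rows4 g)"

lemma gram_nth:
  "gram g $ i $ j = Re (g$i$1$1) * Re (g$j$1$1) + Im (g$i$1$1) * Im (g$j$1$1)
     + Re (g$i$1$2) * Re (g$j$1$2) + Im (g$i$1$2) * Im (g$j$1$2)"
  by (simp add: gram_def rows4_def matrix_matrix_mult_def transpose_def sum_4 vector_4_nth)

lemma quad_form_gram:
  "quad_form (gram g) x = (\<Sum>j\<in>UNIV. x$j * Re (g$j$1$1))\<^sup>2 + (\<Sum>j\<in>UNIV. x$j * Im (g$j$1$1))\<^sup>2
     + (\<Sum>j\<in>UNIV. x$j * Re (g$j$1$2))\<^sup>2 + (\<Sum>j\<in>UNIV. x$j * Im (g$j$1$2))\<^sup>2"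
  by (simp add: quad_form_def gram_nth power2_eq_square sum_product algebra_simps
      flip: sum.distrib)

lemma det_gram:
  assumes "g \<in> G"
  shows "det (\<Sum>j\<in>UNIV. x $ j *\<^sub>R g $ j) = complex_of_real (quad_form (gram g) x)"
proof -
  define a where "a = (\<Sum>j\<in>UNIV. x $ j *\<^sub>R g $ j $ 1 $ 1)"
  define b where "b = (\<Sum>j\<in>UNIV. x $ j *\<^sub>R g $ j $ 1 $ 2)"
  have c: "g$j$2$1 = - cnj (g$j$1$2)" "g$j$2$2 = cnj (g$j$1$1)" for j
    using assms by (auto simp: G_def SU2_iff)
  have "(\<Sum>j\<in>UNIV. x $ j *\<^sub>R g $ j $ 2 $ 2) = cnj a" "(\<Sum>j\<in>UNIV. x $ j *\<^sub>R g $ j $ 2 $ 1) = - cnj b"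
    by (simp_all add: a_def b_def c sum_negf)
  then have "det (\<Sum>j\<in>UNIV. x $ j *\<^sub>R g $ j) = a * cnj a + b * cnj b"
    by (simp add: det_2 a_def b_def)
  also have "\<dots> = complex_of_real ((Re a)\<^sup>2 + (Im a)\<^sup>2 + (Re b)\<^sup>2 + (Im b)\<^sup>2)"
    by (simp add: complex_mult_cnj)
  also have "(Re a)\<^sup>2 + (Im a)\<^sup>2 + (Re b)\<^sup>2 + (Im b)\<^sup>2 = quad_form (gram g) x"
    by (simp add: quad_form_gram a_def b_def)
  finally show ?thesis .
qed

lemma transpose_gram: "transpose (gram g) = gram g"
  by (simp add: gram_def matrix_transpose_mul)

lemma quad_form_axis: "quad_form S (axis a 1) = S $ a $ a"
proof -
  have "quad_form S (axis a 1) =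
      (\<Sum>i\<in>UNIV. \<Sum>j\<in>UNIV. if j = a then (if i = a then S $ i $ j else 0) else 0)"
    unfolding quad_form_def by (intro sum.cong) (auto simp: axis_def)
  then show ?thesis by simp
qed

lemma quad_form_axis2:
  assumes "a \<noteq> b"
  shows "quad_form S (axis a 1 + axis b 1) = S $ a $ a + S $ a $ b + S $ b $ a + S $ b $ b"
proof -
  have "quad_form S (axis a 1 + axis b 1) =
      (\<Sum>i\<in>UNIV. \<Sum>j\<in>UNIV. (if j = a then (if i = a then S $ i $ j else 0) else 0)
      + (if j = b then (if i = a then S $ i $ j else 0) else 0)
      + (if j = a then (if i = b then S $ i $ j else 0) else 0)
      + (if j = b then (if i = b then S $ i $ j else 0) else 0))"
    unfolding quad_form_def using assms by (intro sum.cong) (auto simp: axis_def)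
  then show ?thesis by (simp add: sum.distrib)
qed

lemma quad_form_inj:
  assumes "transpose S = S" "transpose T = T" "\<And>x. quad_form S x = quad_form T x"
  shows "S = T"
proof -
  have sym: "S $ i $ j = S $ j $ i" "T $ i $ j = T $ j $ i" for i j
    using transpose_symmetric[OF assms(1)] transpose_symmetric[OF assms(2)] by blast+
  have diag: "S $ a $ a = T $ a $ a" for a
    using assms(3)[of "axis a 1"] by (simp add: quad_form_axis)
  have "S $ a $ b = T $ a $ b" for a b
  proof (cases "a = b")
    case False
    then show ?thesis
      using assms(3)[of "axis a 1 + axis b 1"] diag[of a] diag[of b] sym[of b a]
      by (simp add: quad_form_axis2)
  qed (simp add: diag)
  then show ?thesis by (simp add: vec_eq_iff)
qed

lemma SU2_mult:
  assumes "A \<in> SU2" "B \<in> SU2"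
  shows "A ** B \<in> SU2"
proof -
  have adj: "adjoint_matrix (A ** B) = adjoint_matrix B ** adjoint_matrix A"
    by (simp add: adjoint_matrix_def matrix_matrix_mult_def transpose_def vec_eq_iff mult.commute)
  have "adjoint_matrix B ** adjoint_matrix A ** (A ** B)
      = adjoint_matrix B ** (adjoint_matrix A ** A) ** B"
    "A ** B ** (adjoint_matrix B ** adjoint_matrix A)
      = A ** (B ** adjoint_matrix B) ** adjoint_matrix A"
    by (simp_all add: matrix_mul_assoc)
  then show ?thesis using assms by (simp add: SU2_def adj det_mul)
qed

lemma sandwich_scaleR:
  fixes h A q :: "complex^2^2"
  shows "h ** (c *\<^sub>R A) ** q = c *\<^sub>R (h ** A ** q)"
  by (simp add: vec_eq_iff matrix_matrix_mult_def sum_2 algebra_simps)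

lemma sandwich_sum:
  fixes h q :: "complex^2^2"
  assumes "finite I"
  shows "h ** (\<Sum>j\<in>I. f j) ** q = (\<Sum>j\<in>I. h ** f j ** q)"
  using assms
proof (induction I rule: finite_induct)
  case empty
  show ?case by (simp add: vec_eq_iff matrix_matrix_mult_def)
qed (simp add: vec_eq_iff matrix_matrix_mult_def sum_2 algebra_simps)

lemma double_coset_det:
  assumes "g \<in> G" "g' \<in> double_coset g"
  shows "g' \<in> G"
    and "det (\<Sum>j\<in>UNIV. x $ j *\<^sub>R g' $ j) = complex_of_real (quad_form (gram g) x)"
proof -
  obtain h q where hq: "h \<in> SU2" "q \<in> SU2" and g': "g' = (\<chi> j. h ** g $ j ** q)"
    using assms(2) by (auto simp: double_coset_def K_def G_mult_def)
  show "g' \<in> G" using assms(1) hq by (simp add: g' G_def SU2_mult)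
  have "(\<Sum>j\<in>UNIV. x $ j *\<^sub>R g' $ j) = h ** (\<Sum>j\<in>UNIV. x $ j *\<^sub>R g $ j) ** q"
    unfolding sandwich_sum[OF finite] by (simp add: g' sandwich_scaleR)
  then show "det (\<Sum>j\<in>UNIV. x $ j *\<^sub>R g' $ j) = complex_of_real (quad_form (gram g) x)"
    using hq det_gram[OF assms(1), of x] by (simp add: det_mul SU2_def)
qed

lemma zeta_double_coset:
  assumes "g \<in> G"
  shows "zeta (double_coset g) = gram g"
  unfolding zeta_def
proof (rule the_equality)
  have one: "mat 1 \<in> SU2"
    by (simp add: SU2_iff mat_def)
  then have oneK: "(\<chi> j. mat 1) \<in> K"
    by (auto simp: K_def)
  have "g = G_mult (G_mult (\<chi> j. mat 1) g) (\<chi> j. mat 1)"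
    by (simp add: G_mult_def vec_eq_iff)
  then have mem: "g \<in> double_coset g"
    unfolding double_coset_def using oneK by (intro CollectI exI conjI)
  show "transpose (gram g) = gram g \<and> (\<forall>g'\<in>double_coset g. \<forall>x.
      det (\<Sum>j\<in>UNIV. x $ j *\<^sub>R g' $ j) = complex_of_real (quad_form (gram g) x))"
    using transpose_gram double_coset_det(2)[OF assms] by blast
  fix S assume S: "transpose S = S \<and> (\<forall>g'\<in>double_coset g. \<forall>x.
      det (\<Sum>j\<in>UNIV. x $ j *\<^sub>R g' $ j) = complex_of_real (quad_form S x))"
  show "S = gram g"
  proof (rule quad_form_inj)
    show "quad_form S x = quad_form (gram g) x" for x
    proof -
      have "complex_of_real (quad_form S x) = complex_of_real (quad_form (gram g) x)"
        using S mem det_gram[OF assms, of x] by (auto dest!: bspec[OF _ mem])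
      then show ?thesis by (simp only: of_real_eq_iff)
    qed
  qed (use S transpose_gram in auto)
qed

lemma zeta_in_Xi:
  assumes "C \<in> Pi_space"
  shows "zeta C \<in> Xi"
proof -
  obtain g where g: "g \<in> G" and C: "C = double_coset g"
    using assms by (auto simp: Pi_space_def)
  have "rank (gram g) \<le> rank (transpose (rows4 g))"
    unfolding gram_def by (rule rank_mul_le_right)
  also have "\<dots> \<le> 4"
    using rank_bound[of "transpose (rows4 g)"] by simp
  finally have "rank (gram g) \<le> 4" .
  moreover have "gram g $ j $ j = 1" for j
    using g by (simp add: gram_nth G_def SU2_iff cmod_power2 add.assoc flip: power2_eq_square)
  ultimately show ?thesis
    by (simp add: C zeta_double_coset[OF g] Xi_def transpose_gram quad_form_gram)
qed

lemma double_coset_measurable: "double_coset \<in> measurable G_borel Pi_borel"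
  unfolding Pi_borel_def
proof (rule measurable_measure_of)
  show "double_coset \<in> space G_borel \<rightarrow> Pi_space"
    by (auto simp: G_borel_def space_restrict_space Pi_space_def)
  fix U :: "((complex^2^2)^'n) set set"
  assume "U \<in> {U. U \<subseteq> Pi_space \<and> openin (top_of_set G) {g \<in> G. double_coset g \<in> U}}"
  then obtain T where T: "open T" "{g \<in> G. double_coset g \<in> U} = G \<inter> T"
    by (auto simp: openin_open)
  have "double_coset -` U \<inter> space G_borel = G \<inter> T"
    using T(2) by (auto simp: G_borel_def space_restrict_space)
  then show "double_coset -` U \<inter> space G_borel \<in> sets G_borel"
    using T(1) by (auto simp: G_borel_def sets_restrict_space)
qed auto

lemma continuous_gram: "continuous_on A gram"
proof -
  have "continuous_on A (\<lambda>g. \<chi> i j. gram g $ i $ j)"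
    unfolding gram_nth by (intro continuous_intros)
  then show ?thesis by simp
qed

lemma zeta_measurable: "zeta \<in> measurable Pi_borel Xi_borel"
proof -
  have sp: "space (Pi_borel :: ((complex^2^2)^'n) set measure) = Pi_space"
    unfolding Pi_borel_def by (rule space_measure_of) auto
  have "zeta \<in> borel_measurable (Pi_borel :: ((complex^2^2)^'n) set measure)"
  proof (rule borel_measurableI)
    fix T :: "(real^'n^'n) set" assume T: "open T"
    have "{g \<in> G. double_coset g \<in> zeta -` T \<inter> Pi_space} = G \<inter> gram -` T"
      by (auto simp: Pi_space_def zeta_double_coset)
    then have "openin (top_of_set G) {g \<in> G. double_coset g \<in> zeta -` T \<inter> Pi_space}"
      using T continuous_gram by (auto intro: continuous_openin_preimage_gen)
    then have "zeta -` T \<inter> Pi_space \<in> sets Pi_borel"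
      unfolding Pi_borel_def by (subst sets_measure_of) (auto intro: sigma_sets.Basic)
    then show "zeta -` T \<inter> space (Pi_borel :: ((complex^2^2)^'n) set measure) \<in> sets Pi_borel"
      by (simp add: sp)
  qed
  then show ?thesis
    unfolding Xi_borel_def
    by (rule measurable_restrict_space2[rotated]) (use zeta_in_Xi sp in auto)
qed

end

theory Submission
  imports Defs "HOL-Analysis.Analysis"
begin

text \<open>Identify \<open>SU(2)\<close> with the unit sphere of \<open>\<real>\<^sup>4\<close>; then the spectral form of \<open>(g\<^sub>1, \<dots>, g\<^sub>n)\<close> has the
  Gram matrix of the corresponding unit vectors \<open>v\<^sub>1, \<dots>, v\<^sub>n\<close>, and invariance of Haar measure allows
  replacing any one \<open>v\<^sub>j\<close> by an independent uniform unit vector.  Given independent unit vectors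
  \<open>u, v, w\<close> with Gram determinant \<open>D\<close> and normal \<open>n = cross4 u v w\<close>, the linear map
  \<open>x \<mapsto> (u \<bullet> x, v \<bullet> x, w \<bullet> x, n \<bullet> x)\<close> has determinant \<open>D\<close>, and the Gram determinant of \<open>u, v, w, x\<close> is
  \<open>(n \<bullet> x)\<^sup>2\<close>.  Exchanging \<open>n \<bullet> x\<close> for \<open>norm x\<close> as the fourth coordinate shows that for uniform unit
  \<open>x\<close> the three inner products have density proportional to the Gram determinant to the power
  \<open>-1/2\<close>.  Integrating out one or two inner products gives the conditional laws for fewer vectors,
  and adding the vectors one after the other yields the joint laws; all normalizing constants are
  fixed in the end by total mass 1.\<close>


subsection \<open>Gram determinants and linear substitution\<close>

text \<open>Lebesgue measure is determined by its values on boxes. The preimage of a box under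
  \<open>V\<close> is its image under the inverse \<open>W\<close>, whose volume is scaled by the
  absolute value of \<open>det W\<close>, the reciprocal of that of \<open>det V\<close>.\<close>

lemma nn_integral_matrix_vector_mult:
  fixes V :: "((real, 'n::{finite,wellorder}) vec, 'n) vec" and g :: "(real, 'n) vec \<Rightarrow> ennreal"
  assumes V: "det V \<noteq> 0" and g[measurable]: "g \<in> borel_measurable borel"
  shows "ennreal \<bar>det V\<bar> * (\<integral>\<^sup>+x. g (V *v x) \<partial>lborel) = (\<integral>\<^sup>+x. g x \<partial>lborel)"
proof -
  have m[measurable]: "(*v) V \<in> borel_measurable borel"
    by (intro borel_measurable_continuous_onI linear_continuous_on) (rule matrix_vector_mul_bounded_linear)
  obtain W where VW: "V ** W = mat 1" and WV: "W ** V = mat 1"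
    using V invertible_det_nz[of V] by (auto simp: invertible_def)
  have dW: "det V * det W = 1" using VW det_mul[of V W] by simp
  have "lborel = density (distr lborel borel ((*v) V)) (\<lambda>_. ennreal \<bar>det V\<bar>)"
  proof (rule lborel_eqI)
    fix l u :: "(real, 'n) vec"
    assume lu: "\<And>b. b \<in> Basis \<Longrightarrow> l \<bullet> b \<le> u \<bullet> b"
    have im: "(*v) V -` box l u = (*v) W ` box l u"
    proof (intro set_eqI iffI)
      fix x assume "x \<in> (*v) V -` box l u"
      moreover have "x = W *v (V *v x)"
        using WV by (simp add: matrix_vector_mul_assoc)
      ultimately show "x \<in> (*v) W ` box l u" by auto
    next
      fix x assume "x \<in> (*v) W ` box l u"
      then show "x \<in> (*v) V -` box l u"
        using VW by (auto simp: matrix_vector_mul_assoc)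
    qed
    have lin: "linear ((*v) W)" by simp
    have im': "(*v) W ` box l u \<in> lmeasurable"
      by (intro measurable_linear_image lin) auto
    have "(*v) W ` box l u \<in> sets borel"
      unfolding im[symmetric] using measurable_sets[OF m, of "box l u"] by simp
    then have "emeasure lborel ((*v) W ` box l u) = emeasure lebesgue ((*v) W ` box l u)"
      by simp
    also have "\<dots> = ennreal (measure lebesgue ((*v) W ` box l u))"
      using im' by (simp add: emeasure_eq_measure2)
    also have "\<dots> = ennreal (\<bar>det W\<bar> * measure lebesgue (box l u))"
      by (subst measure_linear_image[OF lin]) auto
    also have "measure lebesgue (box l u) = (\<Prod>b\<in>Basis. (u - l) \<bullet> b)"
      using lu by (simp add: measure_lborel_box)
    finally have "emeasure lborel ((*v) V -` box l u) = ennreal (\<bar>det W\<bar> * (\<Prod>b\<in>Basis. (u - l) \<bullet> b))"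
      by (simp add: im)
    then have "emeasure (density (distr lborel borel ((*v) V)) (\<lambda>_. ennreal \<bar>det V\<bar>)) (box l u)
        = ennreal \<bar>det V\<bar> * ennreal (\<bar>det W\<bar> * (\<Prod>b\<in>Basis. (u - l) \<bullet> b))"
      by (simp add: emeasure_density nn_integral_cmult emeasure_distr)
    also have "\<dots> = ennreal (\<bar>det V * det W\<bar> * (\<Prod>b\<in>Basis. (u - l) \<bullet> b))"
      using lu by (subst ennreal_mult[symmetric])
        (auto simp: abs_mult mult.assoc inner_diff_left intro!: mult_nonneg_nonneg prod_nonneg)
    finally show "emeasure (density (distr lborel borel ((*v) V)) (\<lambda>_. ennreal \<bar>det V\<bar>)) (box l u)
        = ennreal (\<Prod>b\<in>Basis. (u - l) \<bullet> b)"
      by (simp add: dW)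
  qed simp
  then have "(\<integral>\<^sup>+x. g x \<partial>lborel)
      = (\<integral>\<^sup>+x. g x \<partial>density (distr lborel borel ((*v) V)) (\<lambda>_. ennreal \<bar>det V\<bar>))"
    by simp
  then show ?thesis
    by (simp add: nn_integral_density nn_integral_cmult nn_integral_distr)
qed

lemma measurable_vec_lambda [measurable (raw)]:
  fixes f :: "'i::finite \<Rightarrow> 'a \<Rightarrow> 'b::euclidean_space"
  assumes "\<And>i. f i \<in> borel_measurable M"
  shows "(\<lambda>x. \<chi> i. f i x) \<in> borel_measurable M"
proof -
  have "(\<lambda>x. (\<chi> i. f i x) \<bullet> b) \<in> borel_measurable M" if "b \<in> Basis" for b :: "'b^'i"
    using assms that by (auto simp: Basis_vec_def inner_axis)
  then show ?thesis by (subst borel_measurable_euclidean_space) blast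
qed

lemma vector_4_eq: "vector [a, b, c, d] = (\<chi> i. if i = 1 then a else if i = 2 then b else if i = 3 then c else d :: real^4)"
  by (simp add: vec_eq_iff forall_4 vector_4_nth)

lemma measurable_vector_4 [measurable (raw)]:
  fixes a b c d :: "'a \<Rightarrow> real"
  assumes [measurable]: "a \<in> borel_measurable M" "b \<in> borel_measurable M" "c \<in> borel_measurable M" "d \<in> borel_measurable M"
  shows "(\<lambda>x. vector [a x, b x, c x, d x] :: real^4) \<in> borel_measurable M"
proof -
  have "(\<lambda>x. if i = 1 then a x else if i = 2 then b x else if i = 3 then c x else d x) \<in> borel_measurable M" for i :: 4
    by simp
  then show ?thesis unfolding vector_4_eq by (rule measurable_vec_lambda)
qed

lemma emeasure_lborel_Times:
  fixes A :: "'a::euclidean_space set" and B :: "'b::euclidean_space set"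
  assumes "A \<in> sets borel" "B \<in> sets borel"
  shows "emeasure lborel (A \<times> B) = emeasure lborel A * emeasure lborel B"
  unfolding lborel_prod[symmetric] using assms by (intro lborel.emeasure_pair_measure_Times) auto

lemma prod_4: "prod f (UNIV :: 4 set) = f 1 * f 2 * f 3 * f 4"
  unfolding UNIV_4 by (simp add: ac_simps)

text \<open>Connects \<open>real^4\<close>, where linear substitution is available, with iterated
  integrals over four real coordinates. Comparing the measures of boxes suffices.\<close>

lemma lborel_vector_4:
  "distr lborel borel (\<lambda>(a, b, c, d). vector [a, b, c, d]) = (lborel :: (real^4) measure)"
proof (rule lborel_eqI[symmetric])
  fix l u :: "real^4"
  assume lu: "\<And>b. b \<in> Basis \<Longrightarrow> l \<bullet> b \<le> u \<bullet> b"
  then have le: "l $ i \<le> u $ i" for i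
    using lu[of "axis i 1"] by (simp add: inner_axis)
  have em: "emeasure lborel (box (l$i) (u$i)) = ennreal (u$i - l$i)" for i
    using le[of i] by (simp add: box_real)
  have m: "(\<lambda>(a, b, c, d). vector [a, b, c, d] :: real^4) \<in> borel_measurable borel"
    unfolding case_prod_unfold borel_prod[symmetric] by measurable
  have B: "Basis = (\<lambda>i. axis i (1::real)) ` (UNIV :: 4 set)"
    by (auto simp: Basis_vec_def)
  have im: "(\<lambda>(a, b, c, d). vector [a, b, c, d]) -` box l u
      = box (l$1) (u$1) \<times> box (l$2) (u$2) \<times> box (l$3) (u$3) \<times> box (l$4) (u$4)"
    by (auto simp: mem_box_cart forall_4 vector_4_nth mem_box)
  have "emeasure (distr lborel borel (\<lambda>(a, b, c, d). vector [a, b, c, d])) (box l u)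
     = emeasure lborel (box (l$1) (u$1) \<times> box (l$2) (u$2) \<times> box (l$3) (u$3) \<times> box (l$4) (u$4))"
    using m by (simp add: emeasure_distr im)
  also have "\<dots> = ennreal (u$1 - l$1) * (ennreal (u$2 - l$2) * (ennreal (u$3 - l$3) * ennreal (u$4 - l$4)))"
    by (simp only: emeasure_lborel_Times borel_Times borel_open open_box em)
  also have "\<dots> = ennreal (\<Prod>i\<in>UNIV. (u - l) $ i)"
    using le by (simp add: prod_4 ennreal_mult mult.assoc)
  also have "(\<Prod>i\<in>UNIV. (u - l) $ i) = (\<Prod>b\<in>Basis. (u - l) \<bullet> b)"
    unfolding B by (subst prod.reindex) (auto simp: inj_on_def axis_eq_axis inner_axis)
  finally show "emeasure (distr lborel borel (\<lambda>(a, b, c, d). vector [a, b, c, d])) (box l u)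
    = ennreal (\<Prod>b\<in>Basis. (u - l) \<bullet> b)" .
qed simp

section \<open>Determinants in dimension four, the cross product and Gram identities\<close>

lemma det_4:
  "det (A :: 'a::comm_ring_1^4^4) =
     A$1$1 * (A$2$2 * (A$3$3 * A$4$4 - A$3$4 * A$4$3) - A$2$3 * (A$3$2 * A$4$4 - A$3$4 * A$4$2) + A$2$4 * (A$3$2 * A$4$3 - A$3$3 * A$4$2))
   - A$1$2 * (A$2$1 * (A$3$3 * A$4$4 - A$3$4 * A$4$3) - A$2$3 * (A$3$1 * A$4$4 - A$3$4 * A$4$1) + A$2$4 * (A$3$1 * A$4$3 - A$3$3 * A$4$1))
   + A$1$3 * (A$2$1 * (A$3$2 * A$4$4 - A$3$4 * A$4$2) - A$2$2 * (A$3$1 * A$4$4 - A$3$4 * A$4$1) + A$2$4 * (A$3$1 * A$4$2 - A$3$2 * A$4$1))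
   - A$1$4 * (A$2$1 * (A$3$2 * A$4$3 - A$3$3 * A$4$2) - A$2$2 * (A$3$1 * A$4$3 - A$3$3 * A$4$1) + A$2$3 * (A$3$1 * A$4$2 - A$3$2 * A$4$1))"
proof -
  have f1234: "finite {2::4, 3, 4}" "1 \<notin> {2::4, 3, 4}" by auto
  have f234: "finite {3::4, 4}" "2 \<notin> {3::4, 4}" by auto
  have f34: "finite {4::4}" "3 \<notin> {4::4}" by auto
  show ?thesis
    unfolding det_def UNIV_4
    unfolding sum_over_permutations_insert[OF f1234]
    unfolding sum_over_permutations_insert[OF f234]
    unfolding sum_over_permutations_insert[OF f34]
    unfolding permutes_sing
    by (simp add: sign_swap_id permutation_swap_id sign_compose sign_id permutation_compose
       transpose_apply_first transpose_apply_second Transposition.transpose_def algebra_simps)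
qed

text \<open>The cross product of three vectors in dimension four: its entries are the cofactors of
  the last row of a matrix with first rows \<open>u\<close>, \<open>v\<close>, \<open>w\<close>, so
  it is normal to all three.\<close>

definition cross4 :: "real^4 \<Rightarrow> real^4 \<Rightarrow> real^4 \<Rightarrow> real^4" where
  "cross4 u v w = (\<chi> i. det (vector [u, v, w, axis i 1] :: real^4^4))"

lemma det_cross4: "det (vector [u, v, w, x] :: real^4^4) = cross4 u v w \<bullet> x"
  by (simp add: cross4_def det_4 vector_4_nth inner_vec_def sum_4 axis_def algebra_simps)

text \<open>The determinant and the adjugate quadratic form of the matrix \<open>form3 (p, q, r)\<close>.\<close>

definition det3 :: "real \<Rightarrow> real \<Rightarrow> real \<Rightarrow> real" where
  "det3 p q r = 1 + 2 * p * q * r - p\<^sup>2 - q\<^sup>2 - r\<^sup>2"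

definition adj3 :: "real \<Rightarrow> real \<Rightarrow> real \<Rightarrow> real \<Rightarrow> real \<Rightarrow> real \<Rightarrow> real" where
  "adj3 p q r a b c = (1 - r\<^sup>2) * a\<^sup>2 + (1 - q\<^sup>2) * b\<^sup>2 + (1 - p\<^sup>2) * c\<^sup>2
     + 2 * (q * r - p) * a * b + 2 * (p * r - q) * a * c + 2 * (p * q - r) * b * c"

lemma inner_real_4: "(x :: real^4) \<bullet> y = x$1 * y$1 + x$2 * y$2 + x$3 * y$3 + x$4 * y$4"
  by (simp add: inner_vec_def sum_4)

text \<open>Lagrange's identity: the squared length of the normal is the squared volume spanned by
  the three vectors.\<close>

lemma cross4_self:
  assumes "norm u = 1" "norm v = 1" "norm w = 1"
  shows "cross4 u v w \<bullet> cross4 u v w = det3 (u \<bullet> v) (u \<bullet> w) (v \<bullet> w)"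
proof -
  have "u \<bullet> u = 1" "v \<bullet> v = 1" "w \<bullet> w = 1"
    using assms by (simp_all add: norm_eq_1)
  \<comment> \<open>Restoring the factors equal to 1 gives the full Gram determinant, so that the
    identity becomes polynomial in twelve free coordinates.\<close>
  then have "det3 (u \<bullet> v) (u \<bullet> w) (v \<bullet> w)
     = (u \<bullet> u) * (v \<bullet> v) * (w \<bullet> w) + 2 * (u \<bullet> v) * (u \<bullet> w) * (v \<bullet> w)
      - (u \<bullet> v)\<^sup>2 * (w \<bullet> w) - (u \<bullet> w)\<^sup>2 * (v \<bullet> v) - (v \<bullet> w)\<^sup>2 * (u \<bullet> u)"
    by (simp add: det3_def)
  also have "\<dots> = cross4 u v w \<bullet> cross4 u v w"
    by (simp add: inner_real_4 cross4_def det_4 vector_4_nth axis_def) algebra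
  finally show ?thesis ..
qed

text \<open>Both sides are the Gram determinant of \<open>u\<close>, \<open>v\<close>,
  \<open>w\<close>, \<open>x\<close>: the left as the square of a determinant, the right by
  expansion along the row and column that belong to \<open>x\<close>. Solved for
  \<open>norm x\<close>, it expresses the norm through the four linear coordinates.\<close>

lemma cross4_inner_square:
  assumes "norm u = 1" "norm v = 1" "norm w = 1"
  defines "p \<equiv> u \<bullet> v" and "q \<equiv> u \<bullet> w" and "r \<equiv> v \<bullet> w"
  shows "(cross4 u v w \<bullet> x)\<^sup>2 = det3 p q r * (norm x)\<^sup>2 - adj3 p q r (u \<bullet> x) (v \<bullet> x) (w \<bullet> x)"
proof -
  have [simp]: "u \<bullet> u = 1" "v \<bullet> v = 1" "w \<bullet> w = 1"
    using assms(1-3) by (simp_all add: norm_eq_1)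
  let ?V = "vector [u, v, w, x] :: real^4^4"
  have nth: "(?V ** transpose ?V) $ i $ j = ?V $ i \<bullet> ?V $ j" for i j
    by (simp add: matrix_matrix_mult_def transpose_def inner_vec_def)
  have "(cross4 u v w \<bullet> x)\<^sup>2 = det (?V ** transpose ?V)"
    by (simp add: det_mul det_transpose det_cross4 power2_eq_square)
  also have "\<dots> = det3 p q r * (x \<bullet> x) - adj3 p q r (u \<bullet> x) (v \<bullet> x) (w \<bullet> x)"
    unfolding det_4 nth vector_4_nth
    by (simp add: det3_def adj3_def p_def q_def r_def inner_commute) algebra
  finally show ?thesis by (simp add: power2_norm_eq_inner)
qed

subsection \<open>Integrals over the three-sphere\<close>

lemma borel_measurable_fst_comp [measurable (raw)]:
  fixes f :: "'a \<Rightarrow> 'b::second_countable_topology \<times> 'c::second_countable_topology"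
  assumes "f \<in> borel_measurable M"
  shows "(\<lambda>x. fst (f x)) \<in> borel_measurable M"
  using assms unfolding borel_prod[symmetric] by measurable

lemma borel_measurable_snd_comp [measurable (raw)]:
  fixes f :: "'a \<Rightarrow> 'b::second_countable_topology \<times> 'c::second_countable_topology"
  assumes "f \<in> borel_measurable M"
  shows "(\<lambda>x. snd (f x)) \<in> borel_measurable M"
  using assms unfolding borel_prod[symmetric] by measurable

lemma nn_integral_lborel_Times:
  fixes f :: "'a::euclidean_space \<times> 'b::euclidean_space \<Rightarrow> ennreal"
  assumes "f \<in> borel_measurable borel"
  shows "(\<integral>\<^sup>+x. f x \<partial>lborel) = (\<integral>\<^sup>+x. \<integral>\<^sup>+y. f (x, y) \<partial>lborel \<partial>lborel)"
  unfolding lborel_prod[symmetric] using assms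
  by (intro lborel.nn_integral_fst[symmetric]) (simp add: lborel_prod)

lemma nn_integral_lborel_swap:
  fixes f :: "'a::euclidean_space \<Rightarrow> 'b::euclidean_space \<Rightarrow> ennreal"
  assumes "(\<lambda>z. f (fst z) (snd z)) \<in> borel_measurable borel"
  shows "(\<integral>\<^sup>+x. \<integral>\<^sup>+y. f x y \<partial>lborel \<partial>lborel) = (\<integral>\<^sup>+y. \<integral>\<^sup>+x. f x y \<partial>lborel \<partial>lborel)"
  using assms by (intro lborel_pair.Fubini'[symmetric]) (simp add: lborel_prod case_prod_unfold)

lemma nn_integral_lborel_scaleR:
  fixes f :: "'a::euclidean_space \<Rightarrow> ennreal"
  assumes [measurable]: "f \<in> borel_measurable borel" and "c \<noteq> 0"
  shows "(\<integral>\<^sup>+x. f x \<partial>lborel) = ennreal (\<bar>c\<bar> ^ DIM('a)) * (\<integral>\<^sup>+x. f (c *\<^sub>R x) \<partial>lborel)"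
  by (subst lborel_affine[OF assms(2), of 0])
     (simp add: nn_integral_density nn_integral_distr nn_integral_cmult)

text \<open>Substitute N = (a + w^2) / D, so that dN = (2 w / D) dw and w = sqrt (D N - a) on the
  positive half-line. The two signs of w contribute equally, which cancels the factor 2.\<close>

lemma nn_integral_square_substitution:
  fixes k :: "real \<Rightarrow> ennreal"
  assumes [measurable]: "k \<in> borel_measurable borel" and D: "D > 0" and k: "\<And>N. N \<ge> 1 \<Longrightarrow> k N = 0"
  shows "(\<integral>\<^sup>+w. k ((a + w\<^sup>2) / D) \<partial>lborel) =
    ennreal D * (\<integral>\<^sup>+N. k N * indicator {N. a < D * N} N * ennreal (1 / sqrt (D * N - a)) \<partial>lborel)"
proof -
  define F where "F N = k N * indicator {N. a < D * N} N * ennreal (1 / sqrt (D * N - a))" for N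
  define g where "g w = (a + w\<^sup>2) / D" for w
  \<comment> \<open>Chosen so that a + B^2 is at least D: from \<open>B\<close> on, \<open>k\<close>
    vanishes, and the substitution may be made on a bounded interval.\<close>
  define B where "B = sqrt (\<bar>a\<bar> + D)"
  have [measurable]: "F \<in> borel_measurable borel" "g \<in> borel_measurable borel"
    unfolding F_def g_def by measurable
  have B: "B > 0" "B\<^sup>2 = \<bar>a\<bar> + D" using D by (simp_all add: B_def)
  have gB: "g w \<ge> 1" if "w \<ge> B" for w
  proof -
    have "B\<^sup>2 \<le> w\<^sup>2" using that B(1) by (intro power_mono) auto
    then show ?thesis using D B(2) by (simp add: g_def)
  qed
  have F0: "F N = 0" if "N < g 0 \<or> N > g B" for N
    using that
  proof
    assume "N < g 0"
    then have "\<not> a < D * N" using D by (simp add: g_def field_simps)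
    then show ?thesis by (simp add: F_def)
  next
    assume "N > g B"
    then show ?thesis using gB[of B] k[of N] by (simp add: F_def)
  qed
  define P where "P = (\<integral>\<^sup>+w. k (g w) * indicator {0<..} w \<partial>lborel)"
  have "(\<integral>\<^sup>+N. F N \<partial>lborel) = (\<integral>\<^sup>+N. F N * indicator {g 0..g B} N \<partial>lborel)"
    by (intro nn_integral_cong) (auto split: split_indicator simp: not_le F0)
  also have "\<dots> = (\<integral>\<^sup>+w. F (g w) * ennreal (2 * w / D) * indicator {0..B} w \<partial>lborel)"
  proof (rule nn_integral_substitution_aux)
    show "(g has_real_derivative 2 * x / D) (at x)" for x
      unfolding g_def using D by (auto intro!: derivative_eq_intros)
  qed (use B D in \<open>auto intro!: continuous_intros\<close>)
  also have "\<dots> = (\<integral>\<^sup>+w. ennreal (2 / D) * (k (g w) * indicator {0<..} w) \<partial>lborel)"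
  proof (intro nn_integral_cong)
    fix w :: real
    show "F (g w) * ennreal (2 * w / D) * indicator {0..B} w = ennreal (2 / D) * (k (g w) * indicator {0<..} w)"
    proof (cases "0 < w \<and> w \<le> B")
      case True
      have [simp]: "D * g w = a + w\<^sup>2" using D by (simp add: g_def)
      have "ennreal (1 / w) * ennreal (2 * w / D) = ennreal (2 / D)"
        using True D by (subst ennreal_mult[symmetric]) auto
      then show ?thesis using True by (simp add: F_def mult.assoc mult.left_commute mult.commute)
    next
      case False
      then show ?thesis
        using gB[of w] k[of "g w"] by (auto split: split_indicator)
    qed
  qed
  also have "\<dots> = ennreal (2 / D) * P"
    unfolding P_def by (intro nn_integral_cmult) measurable
  finally have "ennreal D * (\<integral>\<^sup>+N. F N \<partial>lborel) = ennreal D * ennreal (2 / D) * P"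
    by (simp add: mult.assoc)
  also have "ennreal D * ennreal (2 / D) = 2"
    using D by (subst ennreal_mult[symmetric]) auto
  finally have F: "ennreal D * (\<integral>\<^sup>+N. F N \<partial>lborel) = 2 * P" .
  \<comment> \<open>The integrand is even in w, so reflection turns the negative half-line into the
    positive one.\<close>
  have neg: "(\<integral>\<^sup>+w. k (g w) * indicator {..<0} w \<partial>lborel) = P"
    unfolding P_def
    by (subst nn_integral_real_affine[where c = "-1" and t = 0]) (auto simp: g_def indicator_def intro!: nn_integral_cong)
  have "(\<integral>\<^sup>+w. k (g w) \<partial>lborel) = (\<integral>\<^sup>+w. k (g w) * indicator {0<..} w + k (g w) * indicator {..<0} w \<partial>lborel)"
    by (rule nn_integral_cong_AE, rule AE_mp[OF AE_lborel_singleton[of 0]]) (auto split: split_indicator)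
  also have "\<dots> = P + P"
    by (subst nn_integral_add) (auto simp: neg P_def)
  finally show ?thesis
    using F by (simp add: F_def g_def mult_2)
qed

text \<open>The matrix with rows \<open>u\<close>, \<open>v\<close>, \<open>w\<close> and their
  normal has as determinant the squared length of the normal, which is the Gram determinant; linear
  substitution does the rest.\<close>

lemma nn_integral_three_inner_cross4:
  fixes G :: "real \<times> real \<times> real \<times> real \<Rightarrow> ennreal"
  assumes "norm u = 1" "norm v = 1" "norm w = 1"
    and D: "det3 (u \<bullet> v) (u \<bullet> w) (v \<bullet> w) > 0" and [measurable]: "G \<in> borel_measurable borel"
  shows "ennreal (det3 (u \<bullet> v) (u \<bullet> w) (v \<bullet> w)) *
      (\<integral>\<^sup>+x. G (u \<bullet> x, v \<bullet> x, w \<bullet> x, cross4 u v w \<bullet> x) \<partial>lborel) = (\<integral>\<^sup>+y. G y \<partial>lborel)"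
proof -
  let ?V = "vector [u, v, w, cross4 u v w] :: real^4^4"
  let ?g = "\<lambda>y::real^4. G (y$1, y$2, y$3, y$4)"
  have det: "det ?V = det3 (u \<bullet> v) (u \<bullet> w) (v \<bullet> w)"
    using cross4_self[OF assms(1-3)] by (simp add: det_cross4)
  have [measurable]: "?g \<in> borel_measurable borel" by measurable
  have nth: "(?V *v x) $ i = ?V $ i \<bullet> x" for x i
    by (simp add: matrix_vector_mult_def inner_vec_def)
  have m: "(\<lambda>(a, b, c, d). vector [a, b, c, d] :: real^4) \<in> borel_measurable borel"
    unfolding case_prod_unfold by measurable
  have "(\<integral>\<^sup>+y. G y \<partial>lborel) = (\<integral>\<^sup>+y. ?g y \<partial>distr lborel borel (\<lambda>(a, b, c, d). vector [a, b, c, d]))"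
    using m by (simp add: nn_integral_distr case_prod_unfold vector_4_nth)
  also have "\<dots> = (\<integral>\<^sup>+y. ?g y \<partial>lborel)" by (simp add: lborel_vector_4)
  also have "\<dots> = ennreal \<bar>det ?V\<bar> * (\<integral>\<^sup>+x. ?g (?V *v x) \<partial>lborel)"
    using D det by (intro nn_integral_matrix_vector_mult[symmetric]) auto
  finally show ?thesis
    using D by (simp add: nth vector_4_nth det)
qed

text \<open>Up to a constant factor, the integral with respect to the uniform measure on the unit sphere:
  \<open>f\<close> is extended radially to the punctured unit ball.\<close>

definition sphere_integral :: "(real^4 \<Rightarrow> ennreal) \<Rightarrow> ennreal" where
  "sphere_integral f = (\<integral>\<^sup>+x. indicator {x. 0 < norm x \<and> norm x < 1} x * f (sgn x) \<partial>lborel)"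

lemma measurable_adj3 [measurable (raw)]:
  assumes [measurable]: "p \<in> borel_measurable M" "q \<in> borel_measurable M" "r \<in> borel_measurable M"
    "a \<in> borel_measurable M" "b \<in> borel_measurable M" "c \<in> borel_measurable M"
  shows "(\<lambda>x. adj3 (p x) (q x) (r x) (a x) (b x) (c x)) \<in> borel_measurable M"
  unfolding adj3_def by measurable

lemma measurable_det3 [measurable (raw)]:
  assumes [measurable]: "p \<in> borel_measurable M" "q \<in> borel_measurable M" "r \<in> borel_measurable M"
  shows "(\<lambda>x. det3 (p x) (q x) (r x)) \<in> borel_measurable M"
  unfolding det3_def by measurable

lemma adj3_scale: "adj3 p q r (s * a) (s * b) (s * c) = s\<^sup>2 * adj3 p q r a b c"
  by (simp add: adj3_def power2_eq_square algebra_simps)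

text \<open>In the coordinates given by the three inner products z and the product d with the
  normal, the squared norm is N = (A z + d^2) / D. Trading d for N produces the weight 1 / sqrt (D N
  - A z). Rescaling z by sqrt N then separates the radial integral from the integral over inner
  products with a unit vector.\<close>

lemma sphere_integral_three:
  fixes f :: "real \<times> real \<times> real \<Rightarrow> ennreal"
  assumes uvw: "norm u = 1" "norm v = 1" "norm w = 1"
  defines "p \<equiv> u \<bullet> v" and "q \<equiv> u \<bullet> w" and "r \<equiv> v \<bullet> w"
  assumes D: "det3 p q r > 0" and [measurable]: "f \<in> borel_measurable borel"
  shows "sphere_integral (\<lambda>x. f (u \<bullet> x, v \<bullet> x, w \<bullet> x)) =
    (\<integral>\<^sup>+N. indicator {0<..<1} N * ennreal N \<partial>lborel) *
    (\<integral>\<^sup>+(a, b, c). indicator {x. 0 < x} (det3 p q r - adj3 p q r a b c) * f (a, b, c)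
        * ennreal (1 / sqrt (det3 p q r - adj3 p q r a b c)) \<partial>lborel)"
proof -
  define D where "D = det3 p q r"
  define A where "A z = adj3 p q r (fst z) (fst (snd z)) (snd (snd z))" for z
  \<comment> \<open>The argument N stands for the squared norm of x; dividing z by sqrt N turns
    inner products with x into inner products with \<open>sgn x\<close>.\<close>
  define \<phi> where "\<phi> N z = indicator {0<..<1} N * f (z /\<^sub>R sqrt N)" for N :: real and z
  define h where "h N z = \<phi> N z * indicator {N. A z < D * N} N * ennreal (1 / sqrt (D * N - A z))" for N z
  define K where "K = (\<integral>\<^sup>+z. indicator {x. 0 < x} (D - A z) * f z * ennreal (1 / sqrt (D - A z)) \<partial>lborel)"
  have [measurable]: "A \<in> borel_measurable borel" unfolding A_def by measurable
  have m\<phi>[measurable (raw)]: "(\<lambda>x. \<phi> (g x) (h x)) \<in> borel_measurable M"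
    if [measurable]: "g \<in> borel_measurable M" "h \<in> borel_measurable M" for g h and M :: "'a measure"
    unfolding \<phi>_def by measurable
  have mh[measurable (raw)]: "(\<lambda>x. h (g x) (k x)) \<in> borel_measurable M"
    if [measurable]: "g \<in> borel_measurable M" "k \<in> borel_measurable M" for g k and M :: "'a measure"
    unfolding h_def indicator_def by measurable
  have D0: "D > 0" using D by (simp add: D_def)
  let ?n = "cross4 u v w"
  let ?G = "\<lambda>(a, b, c, d). \<phi> ((A (a, b, c) + d\<^sup>2) / D) (a, b, c)"
  have norm2: "(A (u \<bullet> x, v \<bullet> x, w \<bullet> x) + (?n \<bullet> x)\<^sup>2) / D = (norm x)\<^sup>2" for x
    using cross4_inner_square[OF uvw, of x] D0 by (simp add: A_def D_def p_def q_def r_def)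
  have [measurable]: "?G \<in> borel_measurable borel"
    unfolding case_prod_unfold by measurable
  have "sphere_integral (\<lambda>x. f (u \<bullet> x, v \<bullet> x, w \<bullet> x)) =
      (\<integral>\<^sup>+x. ?G (u \<bullet> x, v \<bullet> x, w \<bullet> x, ?n \<bullet> x) \<partial>lborel)"
    unfolding sphere_integral_def split norm2
    by (intro nn_integral_cong)
      (auto simp: \<phi>_def sgn_div_norm power_less_one_iff abs_square_less_1 split: split_indicator)
  then have "ennreal D * sphere_integral (\<lambda>x. f (u \<bullet> x, v \<bullet> x, w \<bullet> x)) = (\<integral>\<^sup>+y. ?G y \<partial>lborel)"
    using nn_integral_three_inner_cross4[OF uvw, of ?G] D by (simp add: D_def p_def q_def r_def)
  also have "\<dots> = (\<integral>\<^sup>+a. \<integral>\<^sup>+b. \<integral>\<^sup>+c. \<integral>\<^sup>+d. \<phi> ((A (a, b, c) + d\<^sup>2) / D) (a, b, c) \<partial>lborel \<partial>lborel \<partial>lborel \<partial>lborel)"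
    by (subst nn_integral_lborel_Times; simp)+
  also have "\<dots> = (\<integral>\<^sup>+z. \<integral>\<^sup>+d. \<phi> ((A z + d\<^sup>2) / D) z \<partial>lborel \<partial>lborel)"
    by (subst nn_integral_lborel_Times, measurable)+
  also have "\<dots> = (\<integral>\<^sup>+z. ennreal D * (\<integral>\<^sup>+N. h N z \<partial>lborel) \<partial>lborel)"
    unfolding h_def using D0
    by (intro nn_integral_cong nn_integral_square_substitution) (auto simp: \<phi>_def)
  also have "\<dots> = ennreal D * (\<integral>\<^sup>+z. \<integral>\<^sup>+N. h N z \<partial>lborel \<partial>lborel)"
    by (intro nn_integral_cmult) measurable
  \<comment> \<open>With N outermost it is constant in the inner integral, where the rescaling of z
    takes place.\<close>
  also have "(\<integral>\<^sup>+z. \<integral>\<^sup>+N. h N z \<partial>lborel \<partial>lborel) = (\<integral>\<^sup>+N. \<integral>\<^sup>+z. h N z \<partial>lborel \<partial>lborel)"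
    by (intro nn_integral_lborel_swap) measurable
  also have "\<dots> = (\<integral>\<^sup>+N. indicator {0<..<1} N * ennreal N * K \<partial>lborel)"
  proof (intro nn_integral_cong)
    fix N :: real
    show "(\<integral>\<^sup>+z. h N z \<partial>lborel) = indicator {0<..<1} N * ennreal N * K"
    proof (cases "0 < N \<and> N < 1")
      case True
      then have N: "0 < N" "N < 1" by auto
      have A: "A (sqrt N *\<^sub>R z) = N * A z" for z
      proof -
        have "(sqrt N)\<^sup>2 = N" using N by simp
        then show ?thesis
          by (simp only: A_def adj3_scale fst_scaleR snd_scaleR real_scaleR_def)
      qed
      have "h N (sqrt N *\<^sub>R z) = ennreal (1 / sqrt N) *
          (indicator {x. 0 < x} (D - A z) * f z * ennreal (1 / sqrt (D - A z)))" for z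
      proof (cases "A z < D")
        case True
        have "D * N - N * A z = N * (D - A z)" by (simp add: algebra_simps)
        then have "ennreal (1 / sqrt (D * N - N * A z)) = ennreal (1 / sqrt N) * ennreal (1 / sqrt (D - A z))"
          using True N by (subst ennreal_mult[symmetric]) (auto simp: real_sqrt_mult)
        moreover have "N * A z < D * N" using True N by simp
        ultimately show ?thesis
          using True N by (simp add: h_def A \<phi>_def ac_simps)
      next
        case False
        then have "\<not> N * A z < D * N" using N by simp
        then show ?thesis using False by (simp add: h_def A)
      qed
      \<comment> \<open>The Jacobian in three dimensions contributes (sqrt N)^3 and the weight
        contributes 1 / sqrt N, which leaves the factor N.\<close>
      then have "(\<integral>\<^sup>+z. h N z \<partial>lborel) = ennreal (sqrt N ^ 3) * (ennreal (1 / sqrt N) * K)"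
        unfolding K_def
        by (subst nn_integral_lborel_scaleR[of _ "sqrt N"]) (use N in \<open>auto simp: nn_integral_cmult power3_eq_cube mult.commute\<close>)
      also have "\<dots> = ennreal (sqrt N ^ 3 * (1 / sqrt N)) * K"
        using N by (subst ennreal_mult) (auto simp: mult.assoc)
      also have "sqrt N ^ 3 * (1 / sqrt N) = N"
        using N by (simp add: power3_eq_cube)
      finally show ?thesis using True by simp
    qed (auto simp: h_def \<phi>_def)
  qed
  also have "\<dots> = (\<integral>\<^sup>+N. indicator {0<..<1} N * ennreal N \<partial>lborel) * K"
    by (intro nn_integral_multc) measurable
  finally have "sphere_integral (\<lambda>x. f (u \<bullet> x, v \<bullet> x, w \<bullet> x)) =
    (\<integral>\<^sup>+N. indicator {0<..<1} N * ennreal N \<partial>lborel) * K"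
    using D0 by (simp add: ennreal_mult_cancel_left)
  then show ?thesis by (simp add: K_def A_def D_def case_prod_unfold)
qed

section \<open>Integrating out inner products with auxiliary orthogonal vectors\<close>

lemma unit_orthogonal_exists:
  fixes u v :: "real^4"
  obtains w where "norm w = 1" "u \<bullet> w = 0" "v \<bullet> w = 0"
proof -
  have "dim {u, v} \<le> card {u, v}" by (intro dim_le_card') auto
  also have "\<dots> \<le> 2" by (simp add: card_insert_if)
  finally have "dim {u, v} < DIM(real^4)" by simp
  then obtain x where x: "x \<noteq> 0" "\<And>y. y \<in> span {u, v} \<Longrightarrow> orthogonal x y"
    using orthogonal_to_subspace_exists[of "{u, v}"] by metis
  have "x \<bullet> u = 0" "x \<bullet> v = 0"
    using x(2)[of u] x(2)[of v] by (simp_all add: span_base orthogonal_def)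
  then show ?thesis
    using x(1) by (intro that[of "sgn x"]) (auto simp: norm_sgn sgn_div_norm inner_commute)
qed

lemma borel_measurable_indicator_pos [measurable (raw)]:
  fixes g :: "'a \<Rightarrow> real"
  assumes [measurable]: "g \<in> borel_measurable M"
  shows "(\<lambda>x. indicator {t. 0 < t} (g x) :: ennreal) \<in> borel_measurable M"
proof -
  have "(\<lambda>x. if 0 < g x then 1 else 0 :: ennreal) \<in> borel_measurable M" by measurable
  then show ?thesis by (simp add: indicator_def of_bool_def)
qed

text \<open>The value is 1/2; it stays symbolic because total mass 1 fixes the product of all
  constants later.\<close>

definition radial_const :: ennreal where
  "radial_const = (\<integral>\<^sup>+N. indicator {0<..<1} N * ennreal N \<partial>lborel)"

text \<open>The total mass of the unnormalized arcsine density on the interval from -1 to 1, that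
  is, pi.\<close>

definition arcsine_const :: ennreal where
  "arcsine_const = (\<integral>\<^sup>+s. indicator {x. 0 < x} (1 - s\<^sup>2) * ennreal (1 / sqrt (1 - s\<^sup>2)) \<partial>lborel)"

text \<open>Substituting c = sqrt (e / d) s, the factor sqrt e of the substitution cancels the one
  in the denominator, so for positive e the value no longer depends on e. For other e the integrand
  vanishes.\<close>

lemma nn_integral_arcsine:
  fixes d e :: real
  assumes d: "d > 0"
  shows "(\<integral>\<^sup>+c. indicator {x. 0 < x} (e - d * c\<^sup>2) * ennreal (1 / sqrt (e - d * c\<^sup>2)) \<partial>lborel)
    = indicator {x. 0 < x} e * ennreal (1 / sqrt d) * arcsine_const"
proof (cases "e > 0")
  case True
  define m where "m = sqrt (e / d)"
  have m: "m > 0" "m\<^sup>2 = e / d" using True d by (simp_all add: m_def)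
  have eq: "e - d * (m * s)\<^sup>2 = e * (1 - s\<^sup>2)" for s
    using d by (simp add: power_mult_distrib m(2) algebra_simps)
  have "(\<integral>\<^sup>+c. indicator {x. 0 < x} (e - d * c\<^sup>2) * ennreal (1 / sqrt (e - d * c\<^sup>2)) \<partial>lborel)
    = ennreal m * (\<integral>\<^sup>+s. indicator {x. 0 < x} (e * (1 - s\<^sup>2)) * ennreal (1 / sqrt (e * (1 - s\<^sup>2))) \<partial>lborel)"
    using m(1) by (subst nn_integral_real_affine[where c = m and t = 0]) (auto simp: eq)
  also have "(\<integral>\<^sup>+s. indicator {x. 0 < x} (e * (1 - s\<^sup>2)) * ennreal (1 / sqrt (e * (1 - s\<^sup>2))) \<partial>lborel)
    = (\<integral>\<^sup>+s. ennreal (1 / sqrt e) * (indicator {x. 0 < x} (1 - s\<^sup>2) * ennreal (1 / sqrt (1 - s\<^sup>2))) \<partial>lborel)"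
  proof (intro nn_integral_cong)
    fix s :: real
    show "indicator {x. 0 < x} (e * (1 - s\<^sup>2)) * ennreal (1 / sqrt (e * (1 - s\<^sup>2)))
      = ennreal (1 / sqrt e) * (indicator {x. 0 < x} (1 - s\<^sup>2) * ennreal (1 / sqrt (1 - s\<^sup>2)))"
    proof (cases "1 - s\<^sup>2 > 0")
      case t: True
      then have "ennreal (1 / sqrt (e * (1 - s\<^sup>2))) = ennreal (1 / sqrt e) * ennreal (1 / sqrt (1 - s\<^sup>2))"
        using True by (subst ennreal_mult[symmetric]) (auto simp: real_sqrt_mult)
      then show ?thesis using t True by simp
    next
      case False
      then show ?thesis using True by (simp add: zero_less_mult_iff)
    qed
  qed
  also have "\<dots> = ennreal (1 / sqrt e) * arcsine_const"
    unfolding arcsine_const_def by (intro nn_integral_cmult) measurable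
  also have "ennreal m * (ennreal (1 / sqrt e) * arcsine_const) = ennreal (m * (1 / sqrt e)) * arcsine_const"
    using m(1) True by (subst ennreal_mult) (auto simp: mult.assoc)
  also have "m * (1 / sqrt e) = 1 / sqrt d"
    using True by (simp add: m_def real_sqrt_divide)
  finally show ?thesis using True by simp
next
  case False
  then have "\<not> 0 < e - d * c\<^sup>2" for c
    using mult_nonneg_nonneg[of d "c\<^sup>2"] d by (simp add: not_less del: mult_nonneg_nonneg)
  then show ?thesis using False by simp
qed

text \<open>Add a third unit vector \<open>w\<close> orthogonal to \<open>u\<close> and
  \<open>v\<close> and integrate out its inner product c. With \<open>w\<close> so chosen, c enters
  the Gram determinant only through c^2, and the integral over c is an arcsine integral.\<close>

lemma sphere_integral_two:
  fixes f :: "real \<times> real \<Rightarrow> ennreal"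
  assumes uv: "norm u = 1" "norm v = 1" and p: "p = u \<bullet> v" "p\<^sup>2 < 1"
    and [measurable]: "f \<in> borel_measurable borel"
  shows "sphere_integral (\<lambda>x. f (u \<bullet> x, v \<bullet> x)) = radial_const * arcsine_const *
    (\<integral>\<^sup>+(a, b). indicator {x. 0 < x} (det3 p a b) * f (a, b) * ennreal (1 / sqrt (1 - p\<^sup>2)) \<partial>lborel)"
proof -
  obtain w where w: "norm w = 1" "u \<bullet> w = 0" "v \<bullet> w = 0"
    using unit_orthogonal_exists by blast
  let ?E = "\<lambda>a b c. det3 p a b - (1 - p\<^sup>2) * c\<^sup>2"
  have E: "det3 p 0 0 - adj3 p 0 0 a b c = ?E a b c" for a b c
    by (simp add: det3_def adj3_def algebra_simps)
  have pos: "det3 (u \<bullet> v) (u \<bullet> w) (v \<bullet> w) > 0"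
    using p by (simp add: w det3_def)
  have "(\<lambda>z::real \<times> real \<times> real. (fst z, fst (snd z))) \<in> borel_measurable borel"
    by (intro borel_measurable_continuous_onI continuous_intros)
  then have [measurable]: "(\<lambda>z::real \<times> real \<times> real. f (fst z, fst (snd z))) \<in> borel_measurable borel"
    using assms(5) by (rule measurable_compose)
  let ?h = "\<lambda>z. indicator {x. 0 < x} (det3 p (fst z) (snd z)) * f z * ennreal (1 / sqrt (1 - p\<^sup>2))"
  have "(\<lambda>z. det3 p (fst z) (snd z)) \<in> borel_measurable borel"
    unfolding det3_def by (intro borel_measurable_continuous_onI continuous_intros)
  then have m: "?h \<in> borel_measurable borel"
    using assms(5) by (intro borel_measurable_times_ennreal borel_measurable_indicator_pos) auto
  have inner: "(\<integral>\<^sup>+c. F * (indicator {x. 0 < x} (?E a b c) * ennreal (1 / sqrt (?E a b c))) \<partial>lborel)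
      = indicator {x. 0 < x} (det3 p a b) * F * ennreal (1 / sqrt (1 - p\<^sup>2)) * arcsine_const" for F a b
  proof -
    have "(\<integral>\<^sup>+c. F * (indicator {x. 0 < x} (?E a b c) * ennreal (1 / sqrt (?E a b c))) \<partial>lborel)
      = F * (\<integral>\<^sup>+c. indicator {x. 0 < x} (?E a b c) * ennreal (1 / sqrt (?E a b c)) \<partial>lborel)"
      by (rule nn_integral_cmult) measurable
    also have "\<dots> = F * (indicator {x. 0 < x} (det3 p a b) * ennreal (1 / sqrt (1 - p\<^sup>2)) * arcsine_const)"
      using p(2) by (subst nn_integral_arcsine) auto
    finally show ?thesis by (simp add: mult_ac)
  qed
  have "sphere_integral (\<lambda>x. f (u \<bullet> x, v \<bullet> x)) = radial_const *
    (\<integral>\<^sup>+(a, b, c). indicator {x. 0 < x} (?E a b c) * f (a, b) * ennreal (1 / sqrt (?E a b c)) \<partial>lborel)"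
    using sphere_integral_three[OF uv w(1) pos, of "\<lambda>z. f (fst z, fst (snd z))"]
    by (simp add: w(2,3) p(1)[symmetric] E radial_const_def)
  also have "(\<integral>\<^sup>+(a, b, c). indicator {x. 0 < x} (?E a b c) * f (a, b) * ennreal (1 / sqrt (?E a b c)) \<partial>lborel)
    = (\<integral>\<^sup>+a. \<integral>\<^sup>+b. \<integral>\<^sup>+c. f (a, b) * (indicator {x. 0 < x} (?E a b c) * ennreal (1 / sqrt (?E a b c))) \<partial>lborel \<partial>lborel \<partial>lborel)"
    unfolding case_prod_unfold
    by ((subst nn_integral_lborel_Times, measurable)+) (simp add: mult_ac)
  also have "\<dots> = (\<integral>\<^sup>+a. \<integral>\<^sup>+b. indicator {x. 0 < x} (det3 p a b) * f (a, b) * ennreal (1 / sqrt (1 - p\<^sup>2)) * arcsine_const \<partial>lborel \<partial>lborel)"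
    by (simp add: inner)
  also have "\<dots> = (\<integral>\<^sup>+z. ?h z * arcsine_const \<partial>lborel)"
    using m by (subst nn_integral_lborel_Times) auto
  also have "\<dots> = arcsine_const * (\<integral>\<^sup>+z. ?h z \<partial>lborel)"
    using m by (subst nn_integral_multc) (auto simp: mult.commute)
  also have "?h = (\<lambda>(a, b). indicator {x. 0 < x} (det3 p a b) * f (a, b) * ennreal (1 / sqrt (1 - p\<^sup>2)))"
    by (simp add: fun_eq_iff)
  finally show ?thesis by (simp add: mult.assoc)
qed

text \<open>Add a unit vector orthogonal to \<open>u\<close>. The law of the pair is then flat on
  the unit disc, and the chord at abscissa a has length 2 sqrt (1 - a^2): the semicircle
  law.\<close>

lemma sphere_integral_one:
  fixes f :: "real \<Rightarrow> ennreal"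
  assumes u: "norm u = 1" and [measurable]: "f \<in> borel_measurable borel"
  shows "sphere_integral (\<lambda>x. f (u \<bullet> x)) = radial_const * arcsine_const *
    (\<integral>\<^sup>+a. indicator {a. a\<^sup>2 < 1} a * f a * ennreal (2 * sqrt (1 - a\<^sup>2)) \<partial>lborel)"
proof -
  obtain v where v: "norm v = 1" "u \<bullet> v = 0"
    using unit_orthogonal_exists[of u u] by blast
  have det: "det3 0 a b = 1 - a\<^sup>2 - b\<^sup>2" for a b by (simp add: det3_def)
  have len: "(\<integral>\<^sup>+b. indicator {x. 0 < x} (1 - a\<^sup>2 - b\<^sup>2) \<partial>lborel)
      = indicator {a. a\<^sup>2 < 1} a * ennreal (2 * sqrt (1 - a\<^sup>2))" for a :: real
  proof (cases "a\<^sup>2 < 1")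
    case True
    have "0 < 1 - a\<^sup>2 - b\<^sup>2 \<longleftrightarrow> b \<in> {- sqrt (1 - a\<^sup>2)<..<sqrt (1 - a\<^sup>2)}" for b
    proof -
      have "0 < 1 - a\<^sup>2 - b\<^sup>2 \<longleftrightarrow> \<bar>b\<bar> < sqrt (1 - a\<^sup>2)"
        unfolding real_sqrt_abs[symmetric] real_sqrt_less_iff by linarith
      then show ?thesis by auto
    qed
    then have "(\<integral>\<^sup>+b. indicator {x. 0 < x} (1 - a\<^sup>2 - b\<^sup>2) \<partial>lborel)
        = (\<integral>\<^sup>+b. indicator {- sqrt (1 - a\<^sup>2)<..<sqrt (1 - a\<^sup>2)} b \<partial>lborel)"
      by (intro nn_integral_cong) (simp add: indicator_def)
    also have "\<dots> = ennreal (2 * sqrt (1 - a\<^sup>2))"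
      using True by simp
    finally show ?thesis using True by simp
  next
    case False
    then have "\<not> 0 < 1 - a\<^sup>2 - b\<^sup>2" for b using zero_le_power2[of b] by linarith
    then show ?thesis using False by simp
  qed
  have "sphere_integral (\<lambda>x. f (u \<bullet> x)) = radial_const * arcsine_const *
    (\<integral>\<^sup>+(a, b). indicator {x. 0 < x} (1 - a\<^sup>2 - b\<^sup>2) * f a \<partial>lborel)"
    using sphere_integral_two[OF u v(1), of 0 "\<lambda>z. f (fst z)"] v(2) by (simp add: det)
  also have "(\<integral>\<^sup>+(a, b). indicator {x. 0 < x} (1 - a\<^sup>2 - b\<^sup>2) * f a \<partial>lborel)
    = (\<integral>\<^sup>+a. \<integral>\<^sup>+b. f a * indicator {x. 0 < x} (1 - a\<^sup>2 - b\<^sup>2) \<partial>lborel \<partial>lborel)"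
    unfolding case_prod_unfold by (subst nn_integral_lborel_Times) (measurable, simp add: mult.commute)
  also have "\<dots> = (\<integral>\<^sup>+a. indicator {a. a\<^sup>2 < 1} a * f a * ennreal (2 * sqrt (1 - a\<^sup>2)) \<partial>lborel)"
    by (intro nn_integral_cong, subst nn_integral_cmult) (measurable, simp add: len mult_ac)
  finally show ?thesis .
qed

text \<open>The matrix of \<open>T\<close> has determinant 1 or -1, and \<open>T\<close> preserves
  norms and commutes with \<open>sgn\<close>, so the radial extension is carried along by the linear
  substitution.\<close>

lemma sphere_integral_orthogonal_transformation:
  assumes T: "orthogonal_transformation T" and [measurable]: "f \<in> borel_measurable borel"
  shows "sphere_integral (\<lambda>x. f (T x)) = sphere_integral f"
proof -
  let ?g = "\<lambda>x. indicator {x. 0 < norm x \<and> norm x < 1} x * f (sgn x)"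
  have lin: "linear T" and norm: "norm (T x) = norm x" for x
    using T by (auto simp: orthogonal_transformation)
  have zero: "T x = 0 \<longleftrightarrow> x = 0" for x
    using norm[of x] by (metis norm_eq_zero)
  have "\<bar>det (matrix T)\<bar> = 1"
    using T det_orthogonal_matrix[of "matrix T"] by (auto simp: orthogonal_transformation_matrix)
  moreover have "?g \<in> borel_measurable borel" by measurable
  ultimately have "(\<integral>\<^sup>+x. ?g (matrix T *v x) \<partial>lborel) = (\<integral>\<^sup>+x. ?g x \<partial>lborel)"
    using nn_integral_matrix_vector_mult[of "matrix T" ?g] by fastforce
  then show ?thesis
    using lin by (simp add: sphere_integral_def matrix_works norm zero sgn_div_norm linear_cmul indicator_def)
qed

text \<open>Up to the null set containing only the origin this is the volume of the unit ball,
  positive and finite; hence it may be divided out.\<close>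

lemma sphere_integral_unit: "sphere_integral (\<lambda>_. 1) \<noteq> 0" "sphere_integral (\<lambda>_. 1) \<noteq> \<infinity>"
proof -
  have "sphere_integral (\<lambda>_. 1) = (\<integral>\<^sup>+x. indicator (ball (0 :: real^4) 1) x \<partial>lborel)"
    unfolding sphere_integral_def
    by (rule nn_integral_cong_AE, rule AE_mp[OF AE_lborel_singleton[of 0]]) (auto split: split_indicator)
  then have eq: "sphere_integral (\<lambda>_. 1) = emeasure lborel (ball (0 :: real^4) 1)"
    by simp
  show "sphere_integral (\<lambda>_. 1) \<noteq> \<infinity>"
    unfolding eq using emeasure_bounded_finite[of "ball (0 :: real^4) 1"] by simp
  show "sphere_integral (\<lambda>_. 1) \<noteq> 0"
    unfolding eq using content_ball_pos[of 1 "0 :: real^4"] by (auto simp: measure_def)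
qed

subsection \<open>Averaging with respect to Haar measure\<close>

definition row4 :: "complex^2^2 \<Rightarrow> real^4" where
  "row4 A = vector [Re (A$1$1), Im (A$1$1), Re (A$1$2), Im (A$1$2)]"

text \<open>A right inverse of \<open>row4\<close>: the second row is the one that
  \<open>SU2_iff\<close> prescribes for the given first row.\<close>

definition quaternion_matrix :: "real^4 \<Rightarrow> complex^2^2" where
  "quaternion_matrix x = vector [vector [Complex (x$1) (x$2), Complex (x$3) (x$4)],
     vector [Complex (- x$3) (x$4), Complex (x$1) (- x$2)]]"

text \<open>The Hamilton product with respect to the basis 1, i, j, k.\<close>

definition quaternion_mult :: "real^4 \<Rightarrow> real^4 \<Rightarrow> real^4" where
  "quaternion_mult x y = vector [
     x$1 * y$1 - x$2 * y$2 - x$3 * y$3 - x$4 * y$4,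
     x$1 * y$2 + x$2 * y$1 + x$3 * y$4 - x$4 * y$3,
     x$1 * y$3 - x$2 * y$4 + x$3 * y$1 + x$4 * y$2,
     x$1 * y$4 + x$2 * y$3 - x$3 * y$2 + x$4 * y$1]"

lemma gram_row4: "gram g $ i $ j = row4 (g$i) \<bullet> row4 (g$j)"
  by (simp add: gram_nth row4_def inner_real_4 vector_4_nth)

lemma norm_row4: "A \<in> SU2 \<Longrightarrow> norm (row4 A) = 1"
  by (simp add: norm_eq_1 SU2_iff row4_def inner_real_4 vector_4_nth cmod_power2 add.assoc flip: power2_eq_square)

lemma quaternion_matrix_in_SU2: "norm x = 1 \<Longrightarrow> quaternion_matrix x \<in> SU2"
  by (simp add: SU2_iff quaternion_matrix_def norm_eq_1 inner_real_4 cmod_power2 add.assoc complex_eq_iff flip: power2_eq_square)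

lemma row4_quaternion_matrix_mult:
  "B \<in> SU2 \<Longrightarrow> row4 (quaternion_matrix x ** B) = quaternion_mult x (row4 B)"
  by (simp add: SU2_iff quaternion_matrix_def row4_def quaternion_mult_def vector_4_nth
      matrix_matrix_mult_def sum_2 vec_eq_iff forall_4)

text \<open>Euler's four-square identity: the quaternion norm is multiplicative, so right
  multiplication by a unit quaternion is a linear isometry.\<close>

lemma orthogonal_transformation_quaternion_mult:
  assumes "norm y = 1"
  shows "orthogonal_transformation (\<lambda>x. quaternion_mult x y)"
proof -
  have "linear (\<lambda>x. quaternion_mult x y)"
    by (rule linearI)
      (simp_all add: quaternion_mult_def vec_eq_iff forall_4 vector_4_nth algebra_simps)
  moreover have "norm (quaternion_mult x y) = norm x" for x
  proof -
    have "quaternion_mult x y \<bullet> quaternion_mult x y = (x \<bullet> x) * (y \<bullet> y)"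
      by (simp add: quaternion_mult_def inner_real_4 vector_4_nth) algebra
    also have "y \<bullet> y = 1" using assms by (simp add: norm_eq_1)
    finally show ?thesis by (simp add: norm_eq)
  qed
  ultimately show ?thesis by (simp add: orthogonal_transformation)
qed

lemma borel_measurable_vec_nth [measurable (raw)]:
  fixes f :: "'a \<Rightarrow> real^'n"
  assumes "f \<in> borel_measurable M"
  shows "(\<lambda>x. f x $ i) \<in> borel_measurable M"
  by (rule measurable_compose[OF assms]) (intro borel_measurable_continuous_onI continuous_intros)

lemma continuous_row4: "continuous_on UNIV (\<lambda>g :: (complex^2^2)^'n. row4 (g $ j))"
proof -
  have *: "(\<lambda>g :: (complex^2^2)^'n. row4 (g$j)) = (\<lambda>g. \<chi> i. if i = 1 then Re (g$j$1$1)
      else if i = 2 then Im (g$j$1$1) else if i = 3 then Re (g$j$1$2) else Im (g$j$1$2))"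
    by (simp add: fun_eq_iff row4_def vec_eq_iff forall_4 vector_4_nth)
  have "continuous_on UNIV (\<lambda>g :: (complex^2^2)^'n. if i = 1 then Re (g$j$1$1)
      else if i = 2 then Im (g$j$1$1) else if i = 3 then Re (g$j$1$2) else Im (g$j$1$2))" for i :: 4
    by (cases "i = 1"; cases "i = 2"; cases "i = 3") (auto intro!: continuous_intros)
  then show ?thesis
    unfolding * by (rule continuous_on_vec_lambda)
qed

lemma continuous_G_mult: "continuous_on UNIV (G_mult h)"
  unfolding G_mult_def matrix_matrix_mult_def
  by (intro continuous_on_vec_lambda) (auto intro!: continuous_intros)

section \<open>Replacing one factor of a Haar-distributed tuple by a uniform unit vector\<close>

locale haar =
  fixes M :: "((complex^2^2)^'n) measure"
  assumes haar: "haar_measure_G M"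
begin

lemma sets_M: "sets M = sets (restrict_space borel G)"
  and prob: "prob_space M"
  and invariant: "h \<in> G \<Longrightarrow> distr M M (G_mult h) = M"
  using haar by (auto simp: haar_measure_G_def G_borel_def)

lemma space_M: "space M = G"
  using sets_eq_imp_space_eq[OF sets_M] by (simp add: space_restrict_space)

lemma measurable_M_continuous: "continuous_on UNIV f \<Longrightarrow> f \<in> borel_measurable M"
  unfolding measurable_cong_sets[OF sets_M refl]
  by (intro measurable_restrict_space1 borel_measurable_continuous_onI)

lemma measurable_row4 [measurable (raw)]:
  "a \<in> measurable N M \<Longrightarrow> (\<lambda>x. row4 (a x $ j)) \<in> borel_measurable N"
  by (erule measurable_compose) (rule measurable_M_continuous[OF continuous_row4])

lemma measurable_G_mult:
  assumes "h \<in> G"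
  shows "G_mult h \<in> measurable M M"
  unfolding measurable_cong_sets[OF sets_M sets_M] using assms
  by (intro measurable_restrict_space2 measurable_restrict_space1 borel_measurable_continuous_onI continuous_G_mult)
    (auto simp: space_restrict_space G_def G_mult_def SU2_mult)

lemma norm_row4_nth: "g \<in> space M \<Longrightarrow> norm (row4 (g $ j)) = 1"
  by (simp add: space_M G_def norm_row4)

text \<open>Left invariance moves \<open>g\<^sub>j\<close> to \<open>x g\<^sub>j\<close> for a unit quaternion \<open>x\<close>; averaging over \<open>x\<close> and
  using that right multiplication by \<open>g\<^sub>j\<close> is a rotation makes the \<open>j\<close>-th factor uniform.\<close>

lemma nn_integral_average:
  fixes H :: "(complex^2^2)^'n \<Rightarrow> real^4 \<Rightarrow> ennreal"
  assumes mH: "(\<lambda>z. H (fst z) (snd z)) \<in> borel_measurable (M \<Otimes>\<^sub>M borel)"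
    and indep: "\<And>g A x. g \<in> G \<Longrightarrow> A \<in> SU2 \<Longrightarrow> H (\<chi> i. if i = j then A else g $ i) x = H g x"
  shows "(\<integral>\<^sup>+g. H g (row4 (g $ j)) \<partial>M) =
    inverse (sphere_integral (\<lambda>_. 1)) * (\<integral>\<^sup>+g. sphere_integral (H g) \<partial>M)"
proof -
  interpret prob_space M by (rule prob)
  interpret pair_sigma_finite M "lborel :: (real^4) measure" ..
  let ?I = "indicator {x. 0 < norm x \<and> norm x < 1} :: real^4 \<Rightarrow> ennreal"
  have m2: "(\<lambda>x. H (a x) (b x)) \<in> borel_measurable N"
    if "a \<in> measurable N M" "b \<in> borel_measurable N" for a b and N :: "'b measure"
    using measurable_compose[OF measurable_Pair[OF that] mH] by simp
  let ?L = "\<integral>\<^sup>+g. H g (row4 (g $ j)) \<partial>M"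
  have mq: "(\<lambda>z. quaternion_mult (sgn (snd z)) (row4 (fst z $ j))) \<in> borel_measurable (M \<Otimes>\<^sub>M lborel)"
    unfolding quaternion_mult_def by measurable
  have step: "?L = (\<integral>\<^sup>+g. H g (quaternion_mult (sgn x) (row4 (g $ j))) \<partial>M)" if "x \<noteq> 0" for x
  proof -
    have x: "quaternion_matrix (sgn x) \<in> SU2"
      using that by (intro quaternion_matrix_in_SU2) (simp add: norm_sgn)
    have one: "mat 1 \<in> SU2" by (simp add: SU2_iff mat_def)
    \<comment> \<open>Translation by \<open>h\<close> alters only the entry at \<open>j\<close>, and
      there the dependence of \<open>H\<close> on the tuple is invisible by \<open>indep\<close>;
      only the vector argument moves.\<close>
    define h :: "(complex^2^2)^'n" where "h = (\<chi> i. if i = j then quaternion_matrix (sgn x) else mat 1)"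
    have h: "h \<in> G" using x one by (simp add: h_def G_def)
    have "?L = (\<integral>\<^sup>+g. H g (row4 (g $ j)) \<partial>distr M M (G_mult h))"
      by (simp add: invariant[OF h])
    also have "\<dots> = (\<integral>\<^sup>+g. H (G_mult h g) (row4 (G_mult h g $ j)) \<partial>M)"
      by (intro nn_integral_distr measurable_G_mult h m2) auto
    also have "\<dots> = (\<integral>\<^sup>+g. H g (quaternion_mult (sgn x) (row4 (g $ j))) \<partial>M)"
    proof (intro nn_integral_cong)
      fix g assume "g \<in> space M"
      then have g: "g \<in> G" by (simp add: space_M)
      then have gj: "g $ j \<in> SU2" by (simp add: G_def)
      have "G_mult h g = (\<chi> i. if i = j then quaternion_matrix (sgn x) ** g $ j else g $ i)"
        by (simp add: G_mult_def h_def vec_eq_iff)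
      then show "H (G_mult h g) (row4 (G_mult h g $ j)) = H g (quaternion_mult (sgn x) (row4 (g $ j)))"
        using indep[OF g SU2_mult[OF x gj]] by (simp add: row4_quaternion_matrix_mult[OF gj])
    qed
    finally show ?thesis .
  qed
  have "sphere_integral (\<lambda>_. 1) * ?L = (\<integral>\<^sup>+x. ?I x * ?L \<partial>lborel)"
    unfolding sphere_integral_def by (subst nn_integral_multc[symmetric]) auto
  also have "\<dots> = (\<integral>\<^sup>+x. \<integral>\<^sup>+g. ?I x * H g (quaternion_mult (sgn x) (row4 (g $ j))) \<partial>M \<partial>lborel)"
  proof (intro nn_integral_cong)
    fix x :: "real^4"
    show "?I x * ?L = (\<integral>\<^sup>+g. ?I x * H g (quaternion_mult (sgn x) (row4 (g $ j))) \<partial>M)"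
      \<comment> \<open>The indicator removes x = 0, where \<open>sgn x\<close> is not a unit vector
        and \<open>step\<close> does not apply.\<close>
      using step[of x] by (cases "0 < norm x \<and> norm x < 1") (auto simp: indicator_def)
  qed
  also have "\<dots> = (\<integral>\<^sup>+g. \<integral>\<^sup>+x. ?I x * H g (quaternion_mult (sgn x) (row4 (g $ j))) \<partial>lborel \<partial>M)"
  proof (rule Fubini')
    have "(\<lambda>z. ?I (snd z) * H (fst z) (quaternion_mult (sgn (snd z)) (row4 (fst z $ j))))
        \<in> borel_measurable (M \<Otimes>\<^sub>M lborel)"
      by (rule borel_measurable_times_ennreal[OF _ m2[OF measurable_fst mq]]) measurable
    then show "(\<lambda>(g, x). ?I x * H g (quaternion_mult (sgn x) (row4 (g $ j))))
        \<in> borel_measurable (M \<Otimes>\<^sub>M lborel)"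
      by (simp add: case_prod_unfold)
  qed
  also have "\<dots> = (\<integral>\<^sup>+g. sphere_integral (H g) \<partial>M)"
  proof (intro nn_integral_cong)
    fix g assume g: "g \<in> space M"
    have "(\<integral>\<^sup>+x. ?I x * H g (quaternion_mult (sgn x) (row4 (g $ j))) \<partial>lborel)
        = sphere_integral (\<lambda>x. H g (quaternion_mult x (row4 (g $ j))))"
      by (simp add: sphere_integral_def)
    \<comment> \<open>For fixed \<open>g\<close>, the map from x to its product with the unit
      quaternion \<open>row4 (g $ j)\<close> is a rotation.\<close>
    also have "\<dots> = sphere_integral (H g)"
      using g by (intro sphere_integral_orthogonal_transformation
          orthogonal_transformation_quaternion_mult norm_row4_nth m2) auto
    finally show "(\<integral>\<^sup>+x. ?I x * H g (quaternion_mult (sgn x) (row4 (g $ j))) \<partial>lborel) = sphere_integral (H g)" .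
  qed
  finally have "inverse (sphere_integral (\<lambda>_. 1)) * (sphere_integral (\<lambda>_. 1) * ?L)
    = inverse (sphere_integral (\<lambda>_. 1)) * (\<integral>\<^sup>+g. sphere_integral (H g) \<partial>M)"
    by simp
  moreover have "inverse (sphere_integral (\<lambda>_. 1)) * sphere_integral (\<lambda>_. 1) = 1"
    using sphere_integral_unit ennreal_divide_self[of "sphere_integral (\<lambda>_. 1)"]
    by (simp add: divide_ennreal_def mult.commute less_top)
  ultimately show ?thesis by (simp add: mult.assoc[symmetric])
qed

end

subsection \<open>The law of the Gram matrix\<close>

lemma borel_measurable_compose_continuous:
  fixes f :: "'a::topological_space \<Rightarrow> 'b::topological_space"
  assumes "g \<in> borel_measurable borel" "continuous_on UNIV f"
  shows "(\<lambda>x. g (f x)) \<in> borel_measurable borel"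
  by (rule measurable_compose[OF borel_measurable_continuous_onI[OF assms(2)] assms(1)])

lemma borel_measurable_nn_integral_lborel:
  fixes F :: "'a::euclidean_space \<Rightarrow> 'b::euclidean_space \<Rightarrow> ennreal"
  assumes "(\<lambda>z. F (fst z) (snd z)) \<in> borel_measurable borel"
  shows "(\<lambda>x. \<integral>\<^sup>+y. F x y \<partial>lborel) \<in> borel_measurable borel"
proof -
  have "(\<lambda>z. F (fst z) (snd z)) \<in> borel_measurable (borel \<Otimes>\<^sub>M lborel)"
    using assms unfolding borel_prod[symmetric]
    by (simp add: measurable_cong_sets[OF sets_pair_measure_cong[OF refl sets_lborel] refl])
  then show ?thesis
    by (intro lborel.borel_measurable_nn_integral) (simp add: case_prod_unfold)
qed

text \<open>Here y collects the inner products among the first three vectors and z those with the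
  fourth, whereas \<open>form4\<close> lists the upper triangle row by row. The two orders differ by
  one exchange of neighbouring variables, which Fubini permits.\<close>

lemma nn_integral_lborel_interleave:
  fixes \<Psi> :: "real \<times> real \<times> real \<times> real \<times> real \<times> real \<Rightarrow> ennreal"
  assumes \<Psi>: "\<Psi> \<in> borel_measurable borel"
  shows "(\<integral>\<^sup>+y. \<integral>\<^sup>+z. \<Psi> (fst y, fst (snd y), fst z, snd (snd y), snd z) \<partial>lborel \<partial>lborel)
    = (\<integral>\<^sup>+x. \<Psi> x \<partial>lborel)"
proof -
  note m = borel_measurable_compose_continuous[OF \<Psi>]
  have "(\<integral>\<^sup>+y. \<integral>\<^sup>+z. \<Psi> (fst y, fst (snd y), fst z, snd (snd y), snd z) \<partial>lborel \<partial>lborel)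
    = (\<integral>\<^sup>+p. \<integral>\<^sup>+y. \<integral>\<^sup>+z. \<Psi> (p, fst y, fst z, snd y, snd z) \<partial>lborel \<partial>lborel \<partial>lborel)"
    by (subst nn_integral_lborel_Times)
      (auto intro!: borel_measurable_nn_integral_lborel m continuous_intros)
  also have "\<dots> = (\<integral>\<^sup>+p. \<integral>\<^sup>+q. \<integral>\<^sup>+r. \<integral>\<^sup>+z. \<Psi> (p, q, fst z, r, snd z) \<partial>lborel \<partial>lborel \<partial>lborel \<partial>lborel)"
    by (subst nn_integral_lborel_Times)
      (auto intro!: borel_measurable_nn_integral_lborel m continuous_intros)
  also have "\<dots> = (\<integral>\<^sup>+p. \<integral>\<^sup>+q. \<integral>\<^sup>+r. \<integral>\<^sup>+a. \<integral>\<^sup>+w. \<Psi> (p, q, a, r, w) \<partial>lborel \<partial>lborel \<partial>lborel \<partial>lborel \<partial>lborel)"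
  proof -
    have "(\<integral>\<^sup>+z. \<Psi> (p, q, fst z, r, snd z) \<partial>lborel) = (\<integral>\<^sup>+a. \<integral>\<^sup>+w. \<Psi> (p, q, a, r, w) \<partial>lborel \<partial>lborel)" for p q r
      by (subst nn_integral_lborel_Times) (auto intro!: m continuous_intros)
    then show ?thesis by simp
  qed
  also have "\<dots> = (\<integral>\<^sup>+p. \<integral>\<^sup>+q. \<integral>\<^sup>+a. \<integral>\<^sup>+r. \<integral>\<^sup>+w. \<Psi> (p, q, a, r, w) \<partial>lborel \<partial>lborel \<partial>lborel \<partial>lborel \<partial>lborel)"
    by (intro nn_integral_cong nn_integral_lborel_swap borel_measurable_nn_integral_lborel m continuous_intros)
  also have "\<dots> = (\<integral>\<^sup>+x. \<Psi> x \<partial>lborel)"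
  proof -
    have "(\<integral>\<^sup>+x. \<Psi> (p, q, a, x) \<partial>lborel) = (\<integral>\<^sup>+r. \<integral>\<^sup>+w. \<Psi> (p, q, a, r, w) \<partial>lborel \<partial>lborel)" for p q a
      by (rule nn_integral_lborel_Times) (intro m continuous_intros)
    moreover have "(\<integral>\<^sup>+x. \<Psi> (p, q, x) \<partial>lborel) = (\<integral>\<^sup>+a. \<integral>\<^sup>+x. \<Psi> (p, q, a, x) \<partial>lborel \<partial>lborel)" for p q
      by (rule nn_integral_lborel_Times) (intro m continuous_intros)
    moreover have "(\<integral>\<^sup>+x. \<Psi> (p, x) \<partial>lborel) = (\<integral>\<^sup>+q. \<integral>\<^sup>+x. \<Psi> (p, q, x) \<partial>lborel \<partial>lborel)" for p
      by (rule nn_integral_lborel_Times) (intro m continuous_intros)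
    ultimately show ?thesis by (simp add: nn_integral_lborel_Times[OF \<Psi>])
  qed
  finally show ?thesis .
qed

text \<open>The normalizing factor of the density 2 sqrt (1 - a^2) of one inner product, that is,
  1/pi.\<close>

definition gram_const :: ennreal where
  "gram_const = inverse (sphere_integral (\<lambda>_. 1)) * (radial_const * arcsine_const)"

text \<open>By Sylvester's criterion, the coordinates of the positive definite forms: the leading
  minors of order two and three are positive.\<close>

definition region3 :: "(real \<times> real \<times> real) set" where
  "region3 = {y. (fst y)\<^sup>2 < 1 \<and> 0 < det3 (fst y) (fst (snd y)) (snd (snd y))}"

lemma continuous_on_det3 [continuous_intros]:
  assumes "continuous_on S p" "continuous_on S q" "continuous_on S r"
  shows "continuous_on S (\<lambda>x. det3 (p x) (q x) (r x))"
  unfolding det3_def using assms by (auto intro!: continuous_intros)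

lemma continuous_on_adj3 [continuous_intros]:
  assumes "continuous_on S p" "continuous_on S q" "continuous_on S r"
    "continuous_on S a" "continuous_on S b" "continuous_on S c"
  shows "continuous_on S (\<lambda>x. adj3 (p x) (q x) (r x) (a x) (b x) (c x))"
  unfolding adj3_def using assms by (auto intro!: continuous_intros)

lemma open_region3: "open region3"
  unfolding region3_def by (auto intro!: open_Collect_conj open_Collect_less continuous_intros)

context haar
begin

text \<open>After averaging over the factor at \<open>j\<close>, the sphere integral has the same
  value for every \<open>g\<close>, so integrating it over a probability measure returns that
  value.\<close>

lemma nn_integral_gram_two:
  fixes f :: "real \<Rightarrow> ennreal"
  assumes ij: "i \<noteq> j" and f: "f \<in> borel_measurable borel"
  shows "(\<integral>\<^sup>+g. f (row4 (g $ i) \<bullet> row4 (g $ j)) \<partial>M) =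
    gram_const * (\<integral>\<^sup>+a. indicator {a. a\<^sup>2 < 1} a * f a * ennreal (2 * sqrt (1 - a\<^sup>2)) \<partial>lborel)"
proof -
  interpret prob_space M by (rule prob)
  note [measurable] = f
  have "(\<lambda>z. f (row4 (fst z $ i) \<bullet> snd z)) \<in> borel_measurable (M \<Otimes>\<^sub>M borel)"
    by measurable
  then have "(\<integral>\<^sup>+g. f (row4 (g $ i) \<bullet> row4 (g $ j)) \<partial>M) =
    inverse (sphere_integral (\<lambda>_. 1)) * (\<integral>\<^sup>+g. sphere_integral (\<lambda>x. f (row4 (g $ i) \<bullet> x)) \<partial>M)"
    using ij by (intro nn_integral_average) auto
  also have "(\<integral>\<^sup>+g. sphere_integral (\<lambda>x. f (row4 (g $ i) \<bullet> x)) \<partial>M) =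
    (\<integral>\<^sup>+g. radial_const * arcsine_const *
      (\<integral>\<^sup>+a. indicator {a. a\<^sup>2 < 1} a * f a * ennreal (2 * sqrt (1 - a\<^sup>2)) \<partial>lborel) \<partial>M)"
    using f by (intro nn_integral_cong sphere_integral_one norm_row4_nth)
  finally show ?thesis
    by (simp add: emeasure_space_1 gram_const_def mult.assoc)
qed

text \<open>The conditional density of the two new inner products given p is proportional to 1 /
  sqrt (1 - p^2), and the density of p to sqrt (1 - p^2). The factors cancel, which makes the joint
  density flat.\<close>

lemma nn_integral_gram_three:
  fixes f :: "real \<times> real \<times> real \<Rightarrow> ennreal"
  assumes ijk: "i \<noteq> j" "i \<noteq> k" "j \<noteq> k" and f: "f \<in> borel_measurable borel"
  shows "(\<integral>\<^sup>+g. f (row4 (g $ i) \<bullet> row4 (g $ j), row4 (g $ i) \<bullet> row4 (g $ k), row4 (g $ j) \<bullet> row4 (g $ k)) \<partial>M) =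
    2 * gram_const\<^sup>2 * (\<integral>\<^sup>+y. indicator region3 y * f y \<partial>lborel)"
proof -
  let ?p = "\<lambda>g. row4 (g $ i) \<bullet> row4 (g $ j)"
  let ?F = "\<lambda>p z. indicator {t. 0 < t} (det3 p (fst z) (snd z)) * f (p, z)"
  define h where "h p = (\<integral>\<^sup>+z. ?F p z * ennreal (1 / sqrt (1 - p\<^sup>2)) \<partial>lborel)" for p
  have "(\<lambda>y::real \<times> real \<times> real. det3 (fst y) (fst (snd y)) (snd (snd y))) \<in> borel_measurable borel"
    by (intro borel_measurable_continuous_onI continuous_intros)
  then have mF: "(\<lambda>y. ?F (fst y) (snd y)) \<in> borel_measurable borel"
    using f by (intro borel_measurable_times_ennreal borel_measurable_indicator_pos) auto
  have "(\<lambda>z::real \<times> real. det3 p (fst z) (snd z)) \<in> borel_measurable borel"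
    "(\<lambda>z. f (p, z)) \<in> borel_measurable borel" for p
    by (rule borel_measurable_continuous_onI, intro continuous_intros)
      (rule borel_measurable_compose_continuous[OF f], intro continuous_intros)
  then have mFp: "?F p \<in> borel_measurable borel" for p
    by (intro borel_measurable_times_ennreal borel_measurable_indicator_pos)
  have ms: "(\<lambda>y::real \<times> real \<times> real. ennreal (1 / sqrt (1 - (fst y)\<^sup>2))) \<in> borel_measurable borel"
    by (rule measurable_compose[of fst borel borel])
       (auto intro!: borel_measurable_continuous_onI continuous_intros)
  have mh: "h \<in> borel_measurable borel"
    unfolding h_def by (intro borel_measurable_nn_integral_lborel borel_measurable_times_ennreal mF ms)
  have mp: "?p \<in> borel_measurable M" by measurable
  have "(\<integral>\<^sup>+g. indicator {a. \<not> a\<^sup>2 < 1} (?p g) \<partial>M) = 0"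
  proof (subst nn_integral_gram_two[OF ijk(1)])
    have "indicator {a. a\<^sup>2 < 1} a * indicator {a. \<not> a\<^sup>2 < 1} a * ennreal (2 * sqrt (1 - a\<^sup>2)) = 0" for a :: real
      by (simp split: split_indicator)
    then show "gram_const * (\<integral>\<^sup>+a. indicator {a. a\<^sup>2 < 1} a * indicator {a. \<not> a\<^sup>2 < 1} a * ennreal (2 * sqrt (1 - a\<^sup>2)) \<partial>lborel) = 0"
      by (simp only: nn_integral_const mult_zero_left mult_zero_right)
  qed measurable
  then have "AE g in M. indicator {a. \<not> a\<^sup>2 < 1} (?p g) = (0 :: ennreal)"
    by (subst (asm) nn_integral_0_iff_AE) (auto intro!: measurable_compose[OF mp])
  \<comment> \<open>The conditional law requires the strict inequality; the two-vector law shows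
    that pairs violating it form a null set.\<close>
  then have ae: "AE g in M. (?p g)\<^sup>2 < 1"
    by eventually_elim (simp add: indicator_def split: if_splits)
  have "(\<lambda>z. f (row4 (fst z $ i) \<bullet> row4 (fst z $ j), row4 (fst z $ i) \<bullet> snd z, row4 (fst z $ j) \<bullet> snd z))
      \<in> borel_measurable (M \<Otimes>\<^sub>M borel)"
    by (rule measurable_compose[OF _ f]) measurable
  then have "(\<integral>\<^sup>+g. f (?p g, row4 (g $ i) \<bullet> row4 (g $ k), row4 (g $ j) \<bullet> row4 (g $ k)) \<partial>M) =
    inverse (sphere_integral (\<lambda>_. 1)) *
      (\<integral>\<^sup>+g. sphere_integral (\<lambda>x. f (?p g, row4 (g $ i) \<bullet> x, row4 (g $ j) \<bullet> x)) \<partial>M)"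
    using ijk by (intro nn_integral_average) auto
  also have "(\<integral>\<^sup>+g. sphere_integral (\<lambda>x. f (?p g, row4 (g $ i) \<bullet> x, row4 (g $ j) \<bullet> x)) \<partial>M)
    = (\<integral>\<^sup>+g. radial_const * arcsine_const * h (?p g) \<partial>M)"
  proof (rule nn_integral_cong_AE, rule AE_mp[OF ae], rule AE_I2, rule impI)
    fix g assume "(?p g)\<^sup>2 < 1" "g \<in> space M"
    then show "sphere_integral (\<lambda>x. f (?p g, row4 (g $ i) \<bullet> x, row4 (g $ j) \<bullet> x))
        = radial_const * arcsine_const * h (?p g)"
      using sphere_integral_two[of "row4 (g $ i)" "row4 (g $ j)" "?p g" "\<lambda>z. f (?p g, z)"]
      by (simp add: norm_row4_nth h_def case_prod_unfold borel_measurable_compose_continuous[OF f] continuous_intros)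
  qed
  also have "\<dots> = radial_const * arcsine_const * (\<integral>\<^sup>+g. h (?p g) \<partial>M)"
    using mp mh by (intro nn_integral_cmult) auto
  also have "(\<integral>\<^sup>+g. h (?p g) \<partial>M) =
      gram_const * (\<integral>\<^sup>+a. indicator {a. a\<^sup>2 < 1} a * h a * ennreal (2 * sqrt (1 - a\<^sup>2)) \<partial>lborel)"
    by (rule nn_integral_gram_two[OF ijk(1) mh])
  also have "(\<integral>\<^sup>+a. indicator {a. a\<^sup>2 < 1} a * h a * ennreal (2 * sqrt (1 - a\<^sup>2)) \<partial>lborel)
    = (\<integral>\<^sup>+a. \<integral>\<^sup>+z. 2 * (indicator region3 (a, z) * f (a, z)) \<partial>lborel \<partial>lborel)"
  proof (intro nn_integral_cong)
    fix a :: real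
    show "indicator {a. a\<^sup>2 < 1} a * h a * ennreal (2 * sqrt (1 - a\<^sup>2))
        = (\<integral>\<^sup>+z. 2 * (indicator region3 (a, z) * f (a, z)) \<partial>lborel)"
    proof (cases "a\<^sup>2 < 1")
      case True
      have "h a = (\<integral>\<^sup>+z. ?F a z \<partial>lborel) * ennreal (1 / sqrt (1 - a\<^sup>2))"
        unfolding h_def by (rule nn_integral_multc) (simp add: mFp)
      \<comment> \<open>The cancellation that leaves a constant density.\<close>
      moreover have "ennreal (1 / sqrt (1 - a\<^sup>2)) * ennreal (2 * sqrt (1 - a\<^sup>2)) = 2"
        using True by (subst ennreal_mult[symmetric]) auto
      ultimately have "indicator {a. a\<^sup>2 < 1} a * h a * ennreal (2 * sqrt (1 - a\<^sup>2)) = (\<integral>\<^sup>+z. ?F a z \<partial>lborel) * 2"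
        using True by (simp add: mult.assoc)
      also have "\<dots> = 2 * (\<integral>\<^sup>+z. ?F a z \<partial>lborel)"
        by (rule mult.commute)
      also have "\<dots> = (\<integral>\<^sup>+z. 2 * ?F a z \<partial>lborel)"
        by (rule nn_integral_cmult[symmetric]) (simp add: mFp)
      also have "\<dots> = (\<integral>\<^sup>+z. 2 * (indicator region3 (a, z) * f (a, z)) \<partial>lborel)"
        using True by (intro nn_integral_cong) (simp add: region3_def indicator_def)
      finally show ?thesis .
    qed (simp add: region3_def)
  qed
  also have "\<dots> = (\<integral>\<^sup>+y. 2 * (indicator region3 y * f y) \<partial>lborel)"
    using f open_region3 by (subst nn_integral_lborel_Times) auto
  also have "\<dots> = 2 * (\<integral>\<^sup>+y. indicator region3 y * f y \<partial>lborel)"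
    using f open_region3 by (intro nn_integral_cmult) auto
  finally show ?thesis
    by (simp add: gram_const_def power2_eq_square mult_ac)
qed

end

text \<open>The determinant of \<open>form4\<close>, expanded along its last row and column so that
  it has literally the shape of the weight in \<open>sphere_integral_three\<close>.\<close>

fun det4 :: "real \<times> real \<times> real \<times> real \<times> real \<times> real \<Rightarrow> real" where
  "det4 (p, q1, q2, r1, r2, t) = det3 p q1 r1 - adj3 p q1 r1 q2 r2 t"

text \<open>Again the positive definite forms, described by their leading minors.\<close>

definition region4 :: "(real \<times> real \<times> real \<times> real \<times> real \<times> real) set" where
  "region4 = {x. (case x of (p, q1, q2, r1, r2, t) \<Rightarrow> (p, q1, r1) \<in> region3) \<and> 0 < det4 x}"

lemma det4_conv: "det4 x = det3 (fst x) (fst (snd x)) (fst (snd (snd (snd x))))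
    - adj3 (fst x) (fst (snd x)) (fst (snd (snd (snd x)))) (fst (snd (snd x)))
        (fst (snd (snd (snd (snd x))))) (snd (snd (snd (snd (snd x)))))"
  by (cases x) simp

lemma continuous_on_det4: "continuous_on UNIV det4"
  unfolding det4_conv[abs_def] by (auto intro!: continuous_intros)

lemma measurable_det4: "det4 \<in> borel_measurable borel"
  by (rule borel_measurable_continuous_onI[OF continuous_on_det4])

lemma open_region4: "open region4"
proof -
  have eq: "region4 = (\<lambda>x. (fst x, fst (snd x), fst (snd (snd (snd x))))) -` region3 \<inter> det4 -` {0<..}"
    by (auto simp: region4_def)
  have "open ((\<lambda>x :: real \<times> real \<times> real \<times> real \<times> real \<times> real. (fst x, fst (snd x), fst (snd (snd (snd x))))) -` region3)"
    by (intro open_vimage open_region3 continuous_intros)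
  moreover have "open (det4 -` {0<..})"
    by (intro open_vimage continuous_on_det4) auto
  ultimately show ?thesis unfolding eq by (rule open_Int)
qed

text \<open>The bound on the dimension yields the rank condition; what remains are closed equalities
  and inequalities in the entries. Measurability of \<open>Xi\<close> follows.\<close>

lemma closed_Xi:
  assumes "CARD('n) \<le> 4"
  shows "closed (Xi :: (real^'n^'n) set)"
proof -
  have "rank S \<le> 4" for S :: "real^'n^'n"
    using rank_bound[of S] assms by simp
  then have eq: "Xi = {S :: real^'n^'n. (\<forall>i j. S $ j $ i = S $ i $ j) \<and> (\<forall>x. 0 \<le> quad_form S x) \<and> (\<forall>j. S $ j $ j = 1)}"
    by (auto simp: Xi_def transpose_def vec_eq_iff)
  show ?thesis
    unfolding eq quad_form_def
    by (auto intro!: closed_Collect_conj closed_Collect_all closed_Collect_le closed_Collect_eq continuous_intros)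
qed

context haar
begin

text \<open>Given the first three vectors, \<open>sphere_integral_three\<close> supplies the
  conditional density of the inner products with the fourth, proportional to the determinant to the
  power -1/2. The law of the first three is flat, so this is also the shape of the joint
  density.\<close>

lemma nn_integral_gram_four:
  fixes f :: "real \<times> real \<times> real \<times> real \<times> real \<times> real \<Rightarrow> ennreal"
  assumes ne: "i \<noteq> j" "i \<noteq> k" "j \<noteq> k" "i \<noteq> l" "j \<noteq> l" "k \<noteq> l" and f: "f \<in> borel_measurable borel"
  shows "(\<integral>\<^sup>+g. f (row4 (g $ i) \<bullet> row4 (g $ j), row4 (g $ i) \<bullet> row4 (g $ k), row4 (g $ i) \<bullet> row4 (g $ l),
      row4 (g $ j) \<bullet> row4 (g $ k), row4 (g $ j) \<bullet> row4 (g $ l), row4 (g $ k) \<bullet> row4 (g $ l)) \<partial>M) =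
    inverse (sphere_integral (\<lambda>_. 1)) * radial_const * (2 * gram_const\<^sup>2) *
      (\<integral>\<^sup>+x. indicator region4 x * f x * ennreal (1 / sqrt (det4 x)) \<partial>lborel)"
proof -
  let ?p = "\<lambda>g. row4 (g $ i) \<bullet> row4 (g $ j)"
  let ?q = "\<lambda>g. row4 (g $ i) \<bullet> row4 (g $ k)"
  let ?r = "\<lambda>g. row4 (g $ j) \<bullet> row4 (g $ k)"
  \<comment> \<open>Merges the products among the first three vectors with those involving the
    fourth into the coordinate order of \<open>form4\<close>.\<close>
  define perm :: "real \<times> real \<times> real \<Rightarrow> real \<times> real \<times> real \<Rightarrow> real \<times> real \<times> real \<times> real \<times> real \<times> real"
    where "perm y z = (fst y, fst (snd y), fst z, snd (snd y), snd z)" for y z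
  define \<Phi> where "\<Phi> x = indicator {t. 0 < t} (det4 x) * f x * ennreal (1 / sqrt (det4 x))" for x
  define \<Psi> where "\<Psi> x = indicator region4 x * f x * ennreal (1 / sqrt (det4 x))" for x
  define h where "h y = (\<integral>\<^sup>+z. \<Phi> (perm y z) \<partial>lborel)" for y
  note [measurable] = measurable_det4 f
  have m\<Phi>: "\<Phi> \<in> borel_measurable borel"
    unfolding \<Phi>_def by measurable
  have [measurable]: "region4 \<in> sets borel"
    using open_region4 by simp
  have m\<Psi>: "\<Psi> \<in> borel_measurable borel"
    unfolding \<Psi>_def by measurable
  have mperm: "(\<lambda>z. F (perm (fst z) (snd z))) \<in> borel_measurable borel" "(\<lambda>z. F (perm y z)) \<in> borel_measurable borel"
    if "F \<in> borel_measurable borel" for F :: "_ \<Rightarrow> ennreal" and y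
    unfolding perm_def by (intro borel_measurable_compose_continuous[OF that] continuous_intros)+
  have mh: "h \<in> borel_measurable borel"
    unfolding h_def by (intro borel_measurable_nn_integral_lborel mperm m\<Phi>)
  have mpqr: "(\<lambda>g. (?p g, ?q g, ?r g)) \<in> borel_measurable M"
    by measurable
  have "(\<integral>\<^sup>+g. indicator (- region3) (?p g, ?q g, ?r g) \<partial>M) = 0"
  proof (subst nn_integral_gram_three[OF ne(1-3)])
    have "indicator region3 y * indicator (- region3) y = (0 :: ennreal)" for y
      by (simp split: split_indicator)
    then show "2 * gram_const\<^sup>2 * (\<integral>\<^sup>+y. indicator region3 y * indicator (- region3) y \<partial>lborel) = 0"
      by (simp only: nn_integral_const mult_zero_left mult_zero_right)
  qed (use open_region3 in auto)
  then have "AE g in M. indicator (- region3) (?p g, ?q g, ?r g) = (0 :: ennreal)"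
    using open_region3 by (subst (asm) nn_integral_0_iff_AE) (auto intro!: measurable_compose[OF mpqr])
  \<comment> \<open>Almost every triple is linearly independent, by the three-vector law tested on
    the complement of \<open>region3\<close>; only then does \<open>sphere_integral_three\<close>
    apply.\<close>
  then have ae: "AE g in M. (?p g, ?q g, ?r g) \<in> region3"
    by eventually_elim (simp add: indicator_def split: if_splits)
  have "(\<lambda>z. (row4 (fst z $ i) \<bullet> row4 (fst z $ j), row4 (fst z $ i) \<bullet> row4 (fst z $ k), row4 (fst z $ i) \<bullet> snd z,
      row4 (fst z $ j) \<bullet> row4 (fst z $ k), row4 (fst z $ j) \<bullet> snd z, row4 (fst z $ k) \<bullet> snd z))
      \<in> borel_measurable (M \<Otimes>\<^sub>M borel)"
    by measurable
  then have "(\<lambda>z. f (row4 (fst z $ i) \<bullet> row4 (fst z $ j), row4 (fst z $ i) \<bullet> row4 (fst z $ k), row4 (fst z $ i) \<bullet> snd z,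
      row4 (fst z $ j) \<bullet> row4 (fst z $ k), row4 (fst z $ j) \<bullet> snd z, row4 (fst z $ k) \<bullet> snd z))
      \<in> borel_measurable (M \<Otimes>\<^sub>M borel)"
    by (rule measurable_compose[OF _ f])
  then have "(\<integral>\<^sup>+g. f (?p g, ?q g, row4 (g $ i) \<bullet> row4 (g $ l), ?r g, row4 (g $ j) \<bullet> row4 (g $ l), row4 (g $ k) \<bullet> row4 (g $ l)) \<partial>M) =
    inverse (sphere_integral (\<lambda>_. 1)) * (\<integral>\<^sup>+g. sphere_integral
      (\<lambda>x. f (?p g, ?q g, row4 (g $ i) \<bullet> x, ?r g, row4 (g $ j) \<bullet> x, row4 (g $ k) \<bullet> x)) \<partial>M)"
    using ne by (intro nn_integral_average) auto
  also have "(\<integral>\<^sup>+g. sphere_integral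
      (\<lambda>x. f (?p g, ?q g, row4 (g $ i) \<bullet> x, ?r g, row4 (g $ j) \<bullet> x, row4 (g $ k) \<bullet> x)) \<partial>M)
    = (\<integral>\<^sup>+g. radial_const * h (?p g, ?q g, ?r g) \<partial>M)"
  proof (rule nn_integral_cong_AE, rule AE_mp[OF ae], rule AE_I2, rule impI)
    fix g assume g: "(?p g, ?q g, ?r g) \<in> region3" "g \<in> space M"
    let ?f = "\<lambda>z. f (?p g, ?q g, fst z, ?r g, snd z)"
    have "?f \<in> borel_measurable borel"
      by (intro borel_measurable_compose_continuous[OF f] continuous_intros)
    then have "sphere_integral (\<lambda>x. ?f (row4 (g $ i) \<bullet> x, row4 (g $ j) \<bullet> x, row4 (g $ k) \<bullet> x)) =
      radial_const * (\<integral>\<^sup>+(a, b, c). indicator {x. 0 < x} (det3 (?p g) (?q g) (?r g) - adj3 (?p g) (?q g) (?r g) a b c) * ?f (a, b, c)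
        * ennreal (1 / sqrt (det3 (?p g) (?q g) (?r g) - adj3 (?p g) (?q g) (?r g) a b c)) \<partial>lborel)"
      unfolding radial_const_def using g
      by (intro sphere_integral_three norm_row4_nth) (auto simp: region3_def)
    also have "(\<integral>\<^sup>+(a, b, c). indicator {x. 0 < x} (det3 (?p g) (?q g) (?r g) - adj3 (?p g) (?q g) (?r g) a b c) * ?f (a, b, c)
        * ennreal (1 / sqrt (det3 (?p g) (?q g) (?r g) - adj3 (?p g) (?q g) (?r g) a b c)) \<partial>lborel) = h (?p g, ?q g, ?r g)"
      by (simp add: h_def \<Phi>_def perm_def det4_conv case_prod_unfold)
    finally show "sphere_integral
      (\<lambda>x. f (?p g, ?q g, row4 (g $ i) \<bullet> x, ?r g, row4 (g $ j) \<bullet> x, row4 (g $ k) \<bullet> x))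
      = radial_const * h (?p g, ?q g, ?r g)" by simp
  qed
  also have "\<dots> = radial_const * (\<integral>\<^sup>+g. h (?p g, ?q g, ?r g) \<partial>M)"
    using measurable_compose[OF mpqr mh] by (intro nn_integral_cmult)
  also have "(\<integral>\<^sup>+g. h (?p g, ?q g, ?r g) \<partial>M) = 2 * gram_const\<^sup>2 * (\<integral>\<^sup>+y. indicator region3 y * h y \<partial>lborel)"
    by (rule nn_integral_gram_three[OF ne(1-3) mh])
  also have "(\<integral>\<^sup>+y. indicator region3 y * h y \<partial>lborel) = (\<integral>\<^sup>+y. \<integral>\<^sup>+z. \<Psi> (perm y z) \<partial>lborel \<partial>lborel)"
  proof (intro nn_integral_cong)
    fix y
    have "indicator region3 y * h y = (\<integral>\<^sup>+z. indicator region3 y * \<Phi> (perm y z) \<partial>lborel)"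
      unfolding h_def by (rule nn_integral_cmult[symmetric]) (simp add: mperm m\<Phi>)
    also have "\<dots> = (\<integral>\<^sup>+z. \<Psi> (perm y z) \<partial>lborel)"
      by (intro nn_integral_cong) (auto simp: \<Phi>_def \<Psi>_def region4_def perm_def case_prod_unfold split: split_indicator)
    finally show "indicator region3 y * h y = (\<integral>\<^sup>+z. \<Psi> (perm y z) \<partial>lborel)" .
  qed
  also have "\<dots> = (\<integral>\<^sup>+x. \<Psi> x \<partial>lborel)"
    unfolding perm_def by (rule nn_integral_lborel_interleave[OF m\<Psi>])
  finally show ?thesis
    by (simp add: \<Psi>_def mult.assoc)
qed

text \<open>On \<open>G\<close> the composition of \<open>zeta\<close> with
  \<open>double_coset\<close> is \<open>gram\<close>, so the quotient disappears and equality of the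
  measures becomes an identity of integrals over tuples. Measurable sets of \<open>Xi_borel\<close>
  are traces of Borel sets, hence the test sets \<open>B\<close>.\<close>

lemma distr_zeta_eqI:
  fixes form :: "'e::euclidean_space \<Rightarrow> real^'n^'n"
  assumes n: "CARD('n) \<le> 4"
    and form: "form \<in> borel_measurable borel"
    and w: "(\<lambda>x. w (form x)) \<in> borel_measurable borel"
    and eq: "\<And>B. B \<in> sets borel \<Longrightarrow> (\<integral>\<^sup>+g. indicator B (gram g) \<partial>M) =
      (\<integral>\<^sup>+x. indicator (form -` Xi) x * (ennreal (w (form x)) * indicator B (form x)) \<partial>lborel)"
  shows "distr (distr M Pi_borel double_coset) Xi_borel zeta =
    distr (density (restrict_space lborel (form -` Xi)) (\<lambda>x. ennreal (w (form x)))) Xi_borel form"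
proof (rule measure_eqI)
  let ?R = "restrict_space lborel (form -` Xi)"
  have Xi: "Xi \<in> sets (borel :: (real^'n^'n) measure)"
    using closed_Xi[OF n] by simp
  have fXi: "form -` Xi \<in> sets borel"
    using measurable_sets[OF form Xi] by simp
  have dc: "double_coset \<in> measurable M Pi_borel"
    using double_coset_measurable unfolding G_borel_def measurable_cong_sets[OF sets_M refl] .
  have mform: "form \<in> measurable ?R Xi_borel"
    unfolding Xi_borel_def using form
    by (intro measurable_restrict_space2 measurable_restrict_space1) (auto simp: space_restrict_space)
  have mw: "(\<lambda>x. ennreal (w (form x))) \<in> borel_measurable ?R"
    using w by (intro measurable_restrict_space1) simp
  have mg: "gram \<in> borel_measurable M"
    by (intro measurable_M_continuous continuous_gram)
  fix A assume "A \<in> sets (distr (distr M Pi_borel double_coset) Xi_borel (zeta :: _ \<Rightarrow> real^'n^'n))"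
  then have A: "A \<in> sets Xi_borel" by simp
  then obtain B where B: "B \<in> sets borel" "A = Xi \<inter> B"
    by (auto simp: Xi_borel_def sets_restrict_space)
  have "emeasure (distr (distr M Pi_borel double_coset) Xi_borel zeta) A
      = emeasure M ((zeta \<circ> double_coset) -` A \<inter> space M)"
    using A by (subst distr_distr[OF zeta_measurable dc], subst emeasure_distr)
      (auto intro!: measurable_comp[OF dc zeta_measurable])
  also have "(zeta \<circ> double_coset) -` A \<inter> space M = gram -` B \<inter> space M"
  proof -
    have "zeta (double_coset g) = gram g \<and> gram g \<in> Xi" if "g \<in> G" for g :: "(complex^2^2)^'n"
      using zeta_in_Xi[of "double_coset g"] that by (auto simp: zeta_double_coset Pi_space_def)
    then show ?thesis by (auto simp: B(2) space_M)
  qed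
  also have "emeasure M (gram -` B \<inter> space M) = (\<integral>\<^sup>+g. indicator B (gram g) \<partial>M)"
  proof -
    have "(\<integral>\<^sup>+g. indicator B (gram g) \<partial>M) = (\<integral>\<^sup>+g. indicator (gram -` B \<inter> space M) g \<partial>M)"
      by (intro nn_integral_cong) (simp add: indicator_def)
    then show ?thesis
      using measurable_sets[OF mg B(1)] by simp
  qed
  also have "\<dots> = (\<integral>\<^sup>+x. indicator (form -` Xi) x * (ennreal (w (form x)) * indicator B (form x)) \<partial>lborel)"
    by (rule eq[OF B(1)])
  also have "\<dots> = (\<integral>\<^sup>+x. ennreal (w (form x)) * indicator (form -` A \<inter> space ?R) x \<partial>?R)"
    using fXi by (subst nn_integral_restrict_space)
      (auto intro!: nn_integral_cong simp: B(2) space_restrict_space split: split_indicator)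
  also have "\<dots> = emeasure (distr (density ?R (\<lambda>x. ennreal (w (form x)))) Xi_borel form) A"
    using A mform mw measurable_sets[OF mform A]
    by (simp add: emeasure_distr emeasure_density)
  finally show "emeasure (distr (distr M Pi_borel double_coset) Xi_borel zeta) A =
    emeasure (distr (density ?R (\<lambda>x. ennreal (w (form x)))) Xi_borel form) A" .
qed simp

end

subsection \<open>Positive semidefinite forms in coordinates\<close>

text \<open>The ternary form as a polynomial in scalars, on which polynomial identities can be
  checked directly.\<close>

definition form3_value :: "real \<Rightarrow> real \<Rightarrow> real \<Rightarrow> real \<Rightarrow> real \<Rightarrow> real \<Rightarrow> real" where
  "form3_value p q r x y z = x\<^sup>2 + y\<^sup>2 + z\<^sup>2 + 2 * p * x * y + 2 * q * x * z + 2 * r * y * z"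

lemma quad_form_form3:
  "quad_form (form3 (p, q, r)) x = form3_value p q r (x$1) (x$2) (x$3)"
  by (simp add: quad_form_def form3_def sum_3 form3_value_def power2_eq_square algebra_simps)

lemma quad_form_form4:
  "quad_form (form4 (p, q1, q2, r1, r2, t)) x = form3_value p q1 r1 (x$1) (x$2) (x$3)
     + (x$4)\<^sup>2 + 2 * q2 * x$1 * x$4 + 2 * r2 * x$2 * x$4 + 2 * t * x$3 * x$4"
  by (simp add: quad_form_def form4_def sum_4 vector_4_nth form3_value_def power2_eq_square algebra_simps)

lemma det_form4: "det (form4 x) = det4 x"
  by (cases x) (simp add: form4_def det_4 vector_4_nth det3_def adj3_def power2_eq_square algebra_simps)

text \<open>Completion of squares in x and then in y, multiplied by 1 - p^2 so that no division
  occurs.\<close>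

lemma form3_value_square:
  "(1 - p\<^sup>2) * form3_value p q r x y z =
    (1 - p\<^sup>2) * (x + p * y + q * z)\<^sup>2 + ((1 - p\<^sup>2) * y + (r - p * q) * z)\<^sup>2 + det3 p q r * z\<^sup>2"
  unfolding form3_value_def det3_def by algebra

lemma form3_value_nonneg:
  assumes "(p, q, r) \<in> region3"
  shows "0 \<le> form3_value p q r x y z"
proof -
  have "p\<^sup>2 < 1" "0 < det3 p q r" using assms by (auto simp: region3_def)
  then have "0 \<le> (1 - p\<^sup>2) * form3_value p q r x y z"
    unfolding form3_value_square by (intro add_nonneg_nonneg mult_nonneg_nonneg) auto
  then show ?thesis using \<open>p\<^sup>2 < 1\<close> by (simp add: zero_le_mult_iff)
qed

text \<open>Completing the square with respect to the last variable: the shift is \<open>w\<close> times the adjugate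
  of the upper left block applied to \<open>(a, b, c)\<close>.\<close>

lemma form4_value_square:
  fixes p q r a b c x y z w :: real
  defines "D \<equiv> det3 p q r"
  shows "D\<^sup>2 * (form3_value p q r x y z + w\<^sup>2 + 2 * a * x * w + 2 * b * y * w + 2 * c * z * w) =
    form3_value p q r (D * x + w * ((1 - r\<^sup>2) * a + (q * r - p) * b + (p * r - q) * c))
      (D * y + w * ((q * r - p) * a + (1 - q\<^sup>2) * b + (p * q - r) * c))
      (D * z + w * ((p * r - q) * a + (p * q - r) * b + (1 - p\<^sup>2) * c))
    + D * (D - adj3 p q r a b c) * w\<^sup>2"
  unfolding D_def form3_value_def det3_def adj3_def by algebra

lemma form3_in_Xi_iff:
  "form3 (p, q, r) \<in> Xi \<longleftrightarrow> (\<forall>x y z. 0 \<le> form3_value p q r x y z)"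
proof -
  have "rank (form3 (p, q, r)) \<le> 4" using rank_bound[of "form3 (p, q, r)"] by simp
  moreover have "transpose (form3 (p, q, r)) = form3 (p, q, r)"
    by (simp add: form3_def transpose_def vec_eq_iff forall_3)
  moreover have "\<forall>j. form3 (p, q, r) $ j $ j = 1"
    by (simp add: form3_def forall_3)
  moreover have "(\<forall>x. 0 \<le> quad_form (form3 (p, q, r)) x) \<longleftrightarrow> (\<forall>x y z. 0 \<le> form3_value p q r x y z)"
  proof (intro iffI allI)
    fix x y z assume "\<forall>x. 0 \<le> quad_form (form3 (p, q, r)) x"
    from this[rule_format, of "vector [x, y, z]"] show "0 \<le> form3_value p q r x y z"
      by (simp add: quad_form_form3)
  qed (simp add: quad_form_form3)
  ultimately show ?thesis by (simp add: Xi_def)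
qed

lemma form4_in_Xi_iff:
  "form4 (p, q1, q2, r1, r2, t) \<in> Xi \<longleftrightarrow> (\<forall>x y z w. 0 \<le> form3_value p q1 r1 x y z
     + w\<^sup>2 + 2 * q2 * x * w + 2 * r2 * y * w + 2 * t * z * w)"
proof -
  let ?S = "form4 (p, q1, q2, r1, r2, t)"
  have "rank ?S \<le> 4" using rank_bound[of ?S] by simp
  moreover have "transpose ?S = ?S"
    by (simp add: form4_def transpose_def vec_eq_iff forall_4 vector_4_nth)
  moreover have "\<forall>j. ?S $ j $ j = 1"
    by (simp add: form4_def forall_4 vector_4_nth)
  moreover have "(\<forall>x. 0 \<le> quad_form ?S x) \<longleftrightarrow> (\<forall>x y z w. 0 \<le> form3_value p q1 r1 x y z
     + w\<^sup>2 + 2 * q2 * x * w + 2 * r2 * y * w + 2 * t * z * w)"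
  proof (intro iffI allI)
    fix x y z w assume "\<forall>x. 0 \<le> quad_form ?S x"
    from this[rule_format, of "vector [x, y, z, w]"]
    show "0 \<le> form3_value p q1 r1 x y z + w\<^sup>2 + 2 * q2 * x * w + 2 * r2 * y * w + 2 * t * z * w"
      by (simp add: quad_form_form4 vector_4_nth)
  qed (simp add: quad_form_form4)
  ultimately show ?thesis by (simp add: Xi_def)
qed

text \<open>Nonnegativity is tested at vectors where the completed squares vanish: (-p, 1, 0) yields
  the second minor, and the last column of the adjugate yields the third minor times the second. The
  two inequations exclude equality.\<close>

lemma region3_if_nonneg:
  assumes "\<And>x y z. 0 \<le> form3_value p q r x y z" "p\<^sup>2 \<noteq> 1" "det3 p q r \<noteq> 0"
  shows "(p, q, r) \<in> region3"
proof -
  have "form3_value p q r (- p) 1 0 = 1 - p\<^sup>2"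
    by (simp add: form3_value_def power2_eq_square)
  then have p: "p\<^sup>2 < 1" using assms(1)[of "- p" 1 0] assms(2) by simp
  have "form3_value p q r (p * r - q) (p * q - r) (1 - p\<^sup>2) = det3 p q r * (1 - p\<^sup>2)"
    unfolding form3_value_def det3_def by algebra
  then have "0 \<le> det3 p q r * (1 - p\<^sup>2)" using assms(1) by metis
  then have "0 \<le> det3 p q r" using p by (simp add: zero_le_mult_iff)
  then show ?thesis using p assms(3) by (simp add: region3_def)
qed

lemma form3_in_Xi_iff_region3:
  assumes "p\<^sup>2 \<noteq> 1" "det3 p q r \<noteq> 0"
  shows "form3 (p, q, r) \<in> Xi \<longleftrightarrow> (p, q, r) \<in> region3"
  using assms region3_if_nonneg form3_value_nonneg unfolding form3_in_Xi_iff by blast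

text \<open>A Schur complement argument based on \<open>form4_value_square\<close>. The determinant
  inequality is not strict, since \<open>Xi\<close> also contains singular forms.\<close>

lemma form4_in_Xi_iff_region4:
  assumes "p\<^sup>2 \<noteq> 1" "det3 p q1 r1 \<noteq> 0"
  shows "form4 (p, q1, q2, r1, r2, t) \<in> Xi \<longleftrightarrow> (p, q1, r1) \<in> region3 \<and> 0 \<le> det4 (p, q1, q2, r1, r2, t)"
proof
  let ?Q = "\<lambda>x y z w. form3_value p q1 r1 x y z + w\<^sup>2 + 2 * q2 * x * w + 2 * r2 * y * w + 2 * t * z * w"
  let ?D = "det3 p q1 r1" and ?u = "(1 - r1\<^sup>2) * q2 + (q1 * r1 - p) * r2 + (p * r1 - q1) * t"
    and ?v = "(q1 * r1 - p) * q2 + (1 - q1\<^sup>2) * r2 + (p * q1 - r1) * t"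
    and ?w = "(p * r1 - q1) * q2 + (p * q1 - r1) * r2 + (1 - p\<^sup>2) * t"
  {
    assume "form4 (p, q1, q2, r1, r2, t) \<in> Xi"
    then have Q: "0 \<le> ?Q x y z w" for x y z w unfolding form4_in_Xi_iff by blast
    have "0 \<le> form3_value p q1 r1 x y z" for x y z using Q[of x y z 0] by simp
    then have r: "(p, q1, r1) \<in> region3" using assms by (rule region3_if_nonneg)
    then have D: "0 < ?D" by (simp add: region3_def)
    \<comment> \<open>At this vector the three shifted arguments cancel and only the term with the
      determinant survives.\<close>
    have "0 \<le> ?D\<^sup>2 * ?Q (- ?u) (- ?v) (- ?w) ?D" using Q by simp
    also have "\<dots> = ?D * det4 (p, q1, q2, r1, r2, t) * ?D\<^sup>2"
      by (subst form4_value_square) (simp add: form3_value_def algebra_simps)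
    finally have "0 \<le> det4 (p, q1, q2, r1, r2, t)"
      using D by (simp add: zero_le_mult_iff)
    then show "(p, q1, r1) \<in> region3 \<and> 0 \<le> det4 (p, q1, q2, r1, r2, t)" using r by simp
  next
    assume r: "(p, q1, r1) \<in> region3 \<and> 0 \<le> det4 (p, q1, q2, r1, r2, t)"
    then have D: "0 < ?D" by (simp add: region3_def)
    have "0 \<le> ?Q x y z w" for x y z w
    proof -
      have "0 \<le> ?D\<^sup>2 * ?Q x y z w"
        unfolding form4_value_square using r D
        by (intro add_nonneg_nonneg mult_nonneg_nonneg form3_value_nonneg) auto
      then show ?thesis using D by (simp add: zero_le_mult_iff)
    qed
    then show "form4 (p, q1, q2, r1, r2, t) \<in> Xi" unfolding form4_in_Xi_iff by blast
  }
qed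

lemma borel_measurable_form3: "form3 \<in> borel_measurable borel"
proof -
  have *: "form3 = (\<lambda>x. \<chi> i j. form3 x $ i $ j)" by simp
  have "continuous_on UNIV (\<lambda>x. form3 x $ i $ j)" for i j
    using exhaust_3[of i] exhaust_3[of j]
    by (safe; simp add: form3_def case_prod_unfold; (intro continuous_intros)?)
  then show ?thesis
    by (subst *) (intro borel_measurable_continuous_onI continuous_on_vec_lambda)
qed

lemma borel_measurable_form4: "form4 \<in> borel_measurable borel"
proof -
  have *: "form4 = (\<lambda>x. \<chi> i j. form4 x $ i $ j)" by simp
  have "continuous_on UNIV (\<lambda>x. form4 x $ i $ j)" for i j
    using exhaust_4[of i] exhaust_4[of j]
    by (safe; simp add: form4_def vector_4_nth case_prod_unfold; (intro continuous_intros)?)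
  then show ?thesis
    by (subst *) (intro borel_measurable_continuous_onI continuous_on_vec_lambda)
qed

section \<open>Vanishing leading minors form a null set\<close>

definition degenerate3 :: "(real \<times> real \<times> real) set" where
  "degenerate3 = {y. (fst y)\<^sup>2 = 1 \<or> det3 (fst y) (fst (snd y)) (snd (snd y)) = 0}"

lemma closed_degenerate3: "closed degenerate3"
  unfolding degenerate3_def by (auto intro!: closed_Collect_disj closed_Collect_eq continuous_intros)

text \<open>For fixed p and q with p^2 different from 1, the determinant is a quadratic polynomial
  in r with at most two zeros. Integrating over r first gives 0, and p = 1 and p = -1 are
  negligible.\<close>

lemma AE_not_degenerate3: "AE y in lborel. y \<notin> degenerate3"
proof -
  have [measurable]: "degenerate3 \<in> sets borel" using closed_degenerate3 by simp
  have m: "(\<lambda>y. indicator degenerate3 y :: ennreal) \<in> borel_measurable borel" by measurable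
  have "{r. (p, q, r) \<in> degenerate3} \<subseteq> {p * q + sqrt ((1 - p\<^sup>2) * (1 - q\<^sup>2)), p * q - sqrt ((1 - p\<^sup>2) * (1 - q\<^sup>2))}"
    if "p\<^sup>2 \<noteq> 1" for p q
  proof
    fix r assume "r \<in> {r. (p, q, r) \<in> degenerate3}"
    \<comment> \<open>The equation \<open>det3 p q r = 0\<close> with the square completed in r.
      Only an inclusion is claimed, so a negative right-hand side does no harm.\<close>
    then have "(r - p * q)\<^sup>2 = (1 - p\<^sup>2) * (1 - q\<^sup>2)"
      using that by (auto simp: degenerate3_def det3_def power2_eq_square algebra_simps)
    then have "\<bar>r - p * q\<bar> = sqrt ((1 - p\<^sup>2) * (1 - q\<^sup>2))"
      by (metis real_sqrt_abs)
    then show "r \<in> {p * q + sqrt ((1 - p\<^sup>2) * (1 - q\<^sup>2)), p * q - sqrt ((1 - p\<^sup>2) * (1 - q\<^sup>2))}"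
      by (auto simp: abs_if split: if_splits)
  qed
  then have fin: "finite {r. (p, q, r) \<in> degenerate3}" if "p\<^sup>2 \<noteq> 1" for p q
    using that by (meson finite.emptyI finite.insertI finite_subset)
  have inner: "(\<integral>\<^sup>+r. indicator degenerate3 (p, q, r) \<partial>lborel) = 0" if "p\<^sup>2 \<noteq> 1" for p q
  proof -
    have "(\<integral>\<^sup>+r. indicator degenerate3 (p, q, r) \<partial>lborel) = (\<integral>\<^sup>+r. indicator {r. (p, q, r) \<in> degenerate3} r \<partial>lborel)"
      by (simp add: indicator_def)
    also have "\<dots> = emeasure lborel {r. (p, q, r) \<in> degenerate3}"
      using fin[OF that, of q] by (intro nn_integral_indicator) (simp add: finite_imp_closed)
    also have "\<dots> = 0" using fin[OF that] by (intro emeasure_lborel_countable countable_finite)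
    finally show ?thesis .
  qed
  have "(\<integral>\<^sup>+y. indicator degenerate3 y \<partial>lborel) =
      (\<integral>\<^sup>+p. \<integral>\<^sup>+q. \<integral>\<^sup>+r. indicator degenerate3 (p, q, r) \<partial>lborel \<partial>lborel \<partial>lborel)"
  proof -
    have "(\<integral>\<^sup>+z. indicator degenerate3 (p, z) \<partial>lborel) = (\<integral>\<^sup>+q. \<integral>\<^sup>+r. indicator degenerate3 (p, q, r) \<partial>lborel \<partial>lborel)" for p
      by (rule nn_integral_lborel_Times) (intro borel_measurable_compose_continuous[OF m] continuous_intros)
    then show ?thesis by (simp only: nn_integral_lborel_Times[OF m])
  qed
  also have "\<dots> = (\<integral>\<^sup>+p. 0 \<partial>(lborel :: real measure))"
  proof (rule nn_integral_cong_AE)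
    have "AE p in lborel. p \<noteq> 1 \<and> p \<noteq> (- 1 :: real)"
      using AE_lborel_singleton[of 1] AE_lborel_singleton[of "- 1"] by eventually_elim simp
    then show "AE p in lborel. (\<integral>\<^sup>+q. \<integral>\<^sup>+r. indicator degenerate3 (p, q, r) \<partial>lborel \<partial>lborel) = 0"
      by eventually_elim (simp add: inner power2_eq_1_iff)
  qed
  finally have "(\<integral>\<^sup>+y. indicator degenerate3 y \<partial>lborel) = 0" by simp
  then have "AE y in lborel. indicator degenerate3 y = (0 :: ennreal)"
    by (subst (asm) nn_integral_0_iff_AE) auto
  then show ?thesis by eventually_elim (simp add: indicator_def split: if_splits)
qed

text \<open>The condition involves only the inner products among the first three vectors;
  integrating over the other three coordinates last reduces it to the case of
  \<open>degenerate3\<close>.\<close>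

lemma AE_not_degenerate4:
  "AE (p, q1, q2, r1, r2, t) in (lborel :: (real \<times> real \<times> real \<times> real \<times> real \<times> real) measure).
    (p, q1, r1) \<notin> degenerate3"
proof -
  let ?\<Psi> = "\<lambda>x :: real \<times> real \<times> real \<times> real \<times> real \<times> real.
    indicator degenerate3 (fst x, fst (snd x), fst (snd (snd (snd x)))) :: ennreal"
  have m: "(\<lambda>y. indicator degenerate3 y :: ennreal) \<in> borel_measurable borel"
    using closed_degenerate3 by simp
  have m\<Psi>: "?\<Psi> \<in> borel_measurable borel"
    by (intro borel_measurable_compose_continuous[OF m] continuous_intros)
  have "(\<integral>\<^sup>+x. ?\<Psi> x \<partial>lborel) = (\<integral>\<^sup>+y. \<integral>\<^sup>+z. indicator degenerate3 y \<partial>(lborel :: (real \<times> real \<times> real) measure) \<partial>lborel)"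
    by (subst nn_integral_lborel_interleave[OF m\<Psi>, symmetric]) simp
  also have "\<dots> = (\<integral>\<^sup>+y. 0 \<partial>(lborel :: (real \<times> real \<times> real) measure))"
    by (rule nn_integral_cong_AE) (use AE_not_degenerate3 in \<open>eventually_elim, simp\<close>)
  finally have "(\<integral>\<^sup>+x. ?\<Psi> x \<partial>lborel) = 0" by simp
  then have "AE x in lborel. ?\<Psi> x = 0"
    using m\<Psi> by (subst (asm) nn_integral_0_iff_AE) auto
  then show ?thesis
    unfolding case_prod_unfold by eventually_elim (simp add: indicator_def split: if_splits)
qed

section \<open>Normalization and the two image measures\<close>

lemma ennreal_factor_of_one:
  fixes C X :: ennreal
  assumes "1 = C * X"
  obtains c where "c > 0" "C = ennreal c"
proof (cases C)
  case (real r)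
  then show ?thesis using assms that[of r] by (cases "r = 0") auto
next
  case top
  then show ?thesis using assms by (cases "X = 0") (auto simp: ennreal_top_mult)
qed

text \<open>The flat law on \<open>region3\<close> is Lebesgue measure on the whole of
  \<open>Xi\<close>, because the two regions agree off the null set
  \<open>degenerate3\<close>.\<close>

lemma zeta_Haar_Xi3:
  fixes M3 :: "((complex^2^2)^3) measure"
  assumes "haar_measure_G M3"
  shows "\<exists>c>0. distr (distr M3 Pi_borel double_coset) Xi_borel zeta = Xi3_measure (\<lambda>S. c)"
proof -
  interpret haar M3 by (standard) (rule assms)
  interpret prob_space M3 by (rule prob)
  let ?C = "2 * gram_const\<^sup>2"
  have gram: "gram g = form3 (row4 (g $ 1) \<bullet> row4 (g $ 2), row4 (g $ 1) \<bullet> row4 (g $ 3), row4 (g $ 2) \<bullet> row4 (g $ 3))"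
    if "g \<in> space M3" for g :: "(complex^2^2)^3"
    using norm_row4_nth[OF that]
    by (simp add: vec_eq_iff forall_3 form3_def gram_row4 inner_commute norm_eq_1)
  have law: "(\<integral>\<^sup>+g. f (row4 (g $ 1) \<bullet> row4 (g $ 2), row4 (g $ 1) \<bullet> row4 (g $ 3), row4 (g $ 2) \<bullet> row4 (g $ 3)) \<partial>M3)
      = ?C * (\<integral>\<^sup>+y. indicator region3 y * f y \<partial>lborel)" if "f \<in> borel_measurable borel" for f
    using that by (intro nn_integral_gram_three) auto
  have "1 = ?C * (\<integral>\<^sup>+y. indicator region3 y \<partial>lborel)"
    using law[of "\<lambda>_. 1"] by (simp add: emeasure_space_1)
  \<comment> \<open>Testing the law against the function 1 shows that the symbolic constant is
    neither 0 nor infinite.\<close>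
  then obtain c where c: "c > 0" "?C = ennreal c"
    by (rule ennreal_factor_of_one)
  have "distr (distr M3 Pi_borel double_coset) Xi_borel zeta = Xi3_measure (\<lambda>S. c)"
    unfolding Xi3_measure_def
  proof (rule distr_zeta_eqI)
    fix B :: "(real^3^3) set" assume B: "B \<in> sets borel"
    have mB: "(\<lambda>y. indicator B (form3 y) :: ennreal) \<in> borel_measurable borel"
      using B by (intro measurable_compose[OF borel_measurable_form3]) simp
    have "(\<integral>\<^sup>+g. indicator B (gram g) \<partial>M3) = ?C * (\<integral>\<^sup>+y. indicator region3 y * indicator B (form3 y) \<partial>lborel)"
      unfolding law[OF mB, symmetric] by (intro nn_integral_cong) (simp add: gram)
    also have "\<dots> = (\<integral>\<^sup>+y. ?C * (indicator region3 y * indicator B (form3 y)) \<partial>lborel)"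
      using mB open_region3 by (intro nn_integral_cmult[symmetric]) auto
    also have "\<dots> = (\<integral>\<^sup>+y. indicator (form3 -` Xi) y * (ennreal c * indicator B (form3 y)) \<partial>lborel)"
    proof (rule nn_integral_cong_AE, rule AE_mp[OF AE_not_degenerate3], rule AE_I2, rule impI)
      fix y assume "y \<notin> degenerate3"
      then have "form3 y \<in> Xi \<longleftrightarrow> y \<in> region3"
        by (cases y) (auto simp: degenerate3_def form3_in_Xi_iff_region3)
      then show "?C * (indicator region3 y * indicator B (form3 y))
        = indicator (form3 -` Xi) y * (ennreal c * indicator B (form3 y))"
        unfolding c(2) by (simp add: indicator_def)
    qed
    finally show "(\<integral>\<^sup>+g. indicator B (gram g) \<partial>M3)
      = (\<integral>\<^sup>+y. indicator (form3 -` Xi) y * (ennreal c * indicator B (form3 y)) \<partial>lborel)" .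
  qed (auto simp: borel_measurable_form3)
  then show ?thesis using c(1) by blast
qed

text \<open>Off the degenerate null set, the preimage of \<open>Xi\<close> exceeds
  \<open>region4\<close> only by coordinates with vanishing determinant, where the stated density is
  0.\<close>

lemma zeta_Haar_Xi4:
  fixes M4 :: "((complex^2^2)^4) measure"
  assumes "haar_measure_G M4"
  shows "\<exists>c>0. distr (distr M4 Pi_borel double_coset) Xi_borel zeta
                 = Xi4_measure (\<lambda>S. c * det S powr (- 1 / 2))"
proof -
  interpret haar M4 by (standard) (rule assms)
  interpret prob_space M4 by (rule prob)
  let ?C = "inverse (sphere_integral (\<lambda>_. 1)) * radial_const * (2 * gram_const\<^sup>2)"
  let ?s = "\<lambda>x. ennreal (1 / sqrt (det4 x))"
  let ?z = "\<lambda>g :: (complex^2^2)^4. (row4 (g $ 1) \<bullet> row4 (g $ 2), row4 (g $ 1) \<bullet> row4 (g $ 3), row4 (g $ 1) \<bullet> row4 (g $ 4),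
      row4 (g $ 2) \<bullet> row4 (g $ 3), row4 (g $ 2) \<bullet> row4 (g $ 4), row4 (g $ 3) \<bullet> row4 (g $ 4))"
  have gram: "gram g = form4 (?z g)" if "g \<in> space M4" for g :: "(complex^2^2)^4"
    using norm_row4_nth[OF that]
    by (simp add: vec_eq_iff forall_4 form4_def vector_4_nth gram_row4 inner_commute norm_eq_1)
  have law: "(\<integral>\<^sup>+g. f (?z g) \<partial>M4) = ?C * (\<integral>\<^sup>+x. indicator region4 x * f x * ?s x \<partial>lborel)"
    if "f \<in> borel_measurable borel" for f
    using that by (intro nn_integral_gram_four) auto
  have "1 = ?C * (\<integral>\<^sup>+x. indicator region4 x * ?s x \<partial>lborel)"
    using law[of "\<lambda>_. 1"] by (simp add: emeasure_space_1)
  then obtain c where c: "c > 0" "?C = ennreal c"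
    by (rule ennreal_factor_of_one)
  note [measurable] = measurable_det4
  have ms: "?s \<in> borel_measurable borel" by measurable
  have "distr (distr M4 Pi_borel double_coset) Xi_borel zeta = Xi4_measure (\<lambda>S. c * det S powr (- 1 / 2))"
    unfolding Xi4_measure_def
  proof (rule distr_zeta_eqI)
    show "(\<lambda>x. c * det (form4 x) powr (- 1 / 2)) \<in> borel_measurable borel"
      unfolding det_form4 by measurable
  next
    fix B :: "(real^4^4) set" assume B: "B \<in> sets borel"
    have mB: "(\<lambda>x. indicator B (form4 x) :: ennreal) \<in> borel_measurable borel"
      using B by (intro measurable_compose[OF borel_measurable_form4]) simp
    have "(\<integral>\<^sup>+g. indicator B (gram g) \<partial>M4) = ?C * (\<integral>\<^sup>+x. indicator region4 x * indicator B (form4 x) * ?s x \<partial>lborel)"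
      unfolding law[OF mB, symmetric] by (intro nn_integral_cong) (simp add: gram)
    also have "\<dots> = (\<integral>\<^sup>+x. ?C * (indicator region4 x * indicator B (form4 x) * ?s x) \<partial>lborel)"
      using mB open_region4 ms by (intro nn_integral_cmult[symmetric]) auto
    also have "\<dots> = (\<integral>\<^sup>+x. indicator (form4 -` Xi) x *
        (ennreal (c * det (form4 x) powr (- 1 / 2)) * indicator B (form4 x)) \<partial>lborel)"
    proof (rule nn_integral_cong_AE, rule AE_mp[OF AE_not_degenerate4], rule AE_I2, rule impI)
      fix x :: "real \<times> real \<times> real \<times> real \<times> real \<times> real"
      assume "case x of (p, q1, q2, r1, r2, t) \<Rightarrow> (p, q1, r1) \<notin> degenerate3"
      then have iff: "form4 x \<in> Xi \<longleftrightarrow> (case x of (p, q1, q2, r1, r2, t) \<Rightarrow> (p, q1, r1) \<in> region3) \<and> 0 \<le> det4 x"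
        by (cases x) (auto simp: degenerate3_def form4_in_Xi_iff_region4 simp del: det4.simps)
      show "?C * (indicator region4 x * indicator B (form4 x) * ?s x) = indicator (form4 -` Xi) x *
        (ennreal (c * det (form4 x) powr (- 1 / 2)) * indicator B (form4 x))"
      proof (cases "x \<in> region4")
        case True
        then have "form4 x \<in> Xi" "0 < det4 x" unfolding iff by (auto simp: region4_def)
        moreover from this have "det4 x powr (- 1 / 2) = 1 / sqrt (det4 x)"
          using powr_minus_divide[of "det4 x" "1 / 2"] by (simp add: powr_half_sqrt)
        moreover have "ennreal (c / sqrt (det4 x)) = ennreal c * ennreal (1 / sqrt (det4 x))"
          using c(1) \<open>0 < det4 x\<close> by (subst ennreal_mult[symmetric]) auto
        ultimately show ?thesis
          using True unfolding c(2) by (simp add: det_form4 mult_ac)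
      next
        case False
        \<comment> \<open>Both sides vanish here: the left by the indicator, the right because x
          lies outside the preimage of \<open>Xi\<close> or because
          \<open>0 powr (- 1 / 2) = 0\<close>.\<close>
        then have "form4 x \<in> Xi \<Longrightarrow> det4 x = 0" unfolding iff by (auto simp: region4_def)
        then show ?thesis using False by (auto simp: det_form4 split: split_indicator)
      qed
    qed
    finally show "(\<integral>\<^sup>+g. indicator B (gram g) \<partial>M4) = (\<integral>\<^sup>+x. indicator (form4 -` Xi) x *
        (ennreal (c * det (form4 x) powr (- 1 / 2)) * indicator B (form4 x)) \<partial>lborel)" .
  qed (auto simp: borel_measurable_form4)
  then show ?thesis using c(1) by blast
qed

theorem theorem3p4:
  fixes M3 :: "((complex^2^2)^3) measure" and M4 :: "((complex^2^2)^4) measure"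
  assumes "haar_measure_G M3" and "haar_measure_G M4"
  shows "(\<exists>c>0. distr (distr M3 Pi_borel double_coset) Xi_borel zeta
                 = Xi3_measure (\<lambda>S. c)) \<and>
         (\<exists>c>0. distr (distr M4 Pi_borel double_coset) Xi_borel zeta
                 = Xi4_measure (\<lambda>S. c * det S powr (- 1 / 2)))"
  using zeta_Haar_Xi3[OF assms(1)] zeta_Haar_Xi4[OF assms(2)] by blast

end
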